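(* Let $\theta$ be a choice function. For all $\theta$-NMDAs $\mathcal{A}$ and $\mathcal{B}$ over $\Sigma$ and every $c\in\mathbb{Q}$, there exist $\theta$-NMDAs $\mathcal{C}_1,\ldots,\mathcal{C}_5$ such that for every word $w$ (in the finite-word setting every $w\in\Sigma^+$, in the infinite-word setting every $w\in\Sigma^\omega$): $\mathcal{C}_1(w)=\min(\mathcal{A}(w),\mathcal{B}(w))$, $\mathcal{C}_2(w)=\max(\mathcal{A}(w),\mathcal{B}(w))$, $\mathcal{C}_3(w)=\mathcal{A}(w)+\mathcal{B}(w)$, $\mathcal{C}_4(w)=\mathcal{A}(w)-\mathcal{B}(w)$, and $\mathcal{C}_5(w)=c\cdot\mathcal{A}(w)$.
   Context: An alphabet $\Sigma$ is a finite nonempty set; $\Sigma^+$ denotes nonempty finite words. An NMDA is a tuple $\mathcal{A}=\langle \Sigma,Q,\iota,\delta,\gamma,\rho\rangle$ with finite state set $Q$, initial states $\iota\subseteq Q$, transition relation $\delta\subseteq Q\times\Sigma\times Q$, weight function $\gamma:\delta\to\mathbb{Q}$ and discount-factor function $\rho:\delta\to\mathbb{Q}\cap(1,\infty)$; NMDAs are assumed complete (every state has at least one outgoing transition on every letter). A run on a finite or infinite word $w=\sigma_0\sigma_1\cdots$ is $p_0,\sigma_0,p_1,\ldots$ with $p_0\in\iota$ and $t_i=(p_i,\sigma_i,p_{i+1})\in\delta$; its value is $\sum_{i}\gamma(t_i)\prod_{j<i}\frac{1}{\rho(t_j)}$, and $\mathcal{A}(w)$ is the infimum of values of runs on $w$.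 An NMDA is integral if all discount factors are integers. For $\theta:\Sigma^+\to\mathbb{N}\setminus\{0,1\}$, an integral NMDA $\mathcal{A}$ is a $\theta$-NMDA if for every $u=\sigma_1\cdots\sigma_n\in\Sigma^+$ and every run $q_0,\sigma_1,\ldots,q_n$ of $\mathcal{A}$ on $u$, $\rho(q_{n-1},\sigma_n,q_n)=\theta(u)$. $\theta$ is a choice function if some integral NMDA is a $\theta$-NMDA. *)

theory Defs
  imports Complex_Main
begin

text \<open>
  Weights and discount factors live in \<^typ>\<open>rat\<close>; only their values on the transitions of
  the automaton matter.
\<close>

record ('s, 'q) nmda =
  alphabet :: "'s set"
  states :: "'q set"
  initials :: "'q set"
  transitions :: "('q \<times> 's \<times> 'q) set"
  weight :: "'q \<times> 's \<times> 'q \<Rightarrow> rat"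
  discount :: "'q \<times> 's \<times> 'q \<Rightarrow> rat"

text \<open>
  Besides completeness, the set of initial states is required to be nonempty, so that every word
  has a run and the value of a word is a real number rather than the infimum of the empty set.
\<close>

definition is_nmda :: "('s, 'q) nmda \<Rightarrow> bool" where
  "is_nmda A \<longleftrightarrow>
     finite (alphabet A) \<and> alphabet A \<noteq> {} \<and>
     finite (states A) \<and>
     initials A \<subseteq> states A \<and> initials A \<noteq> {} \<and>
     transitions A \<subseteq> states A \<times> alphabet A \<times> states A \<and>
     (\<forall>t \<in> transitions A. discount A t > 1) \<and>
     (\<forall>q \<in> states A. \<forall>a \<in> alphabet A. \<exists>q'. (q, a, q') \<in> transitions A)"

definition integral_nmda :: "('s, 'q) nmda \<Rightarrow> bool" where
  "integral_nmda A \<longleftrightarrow> is_nmda A \<and> (\<forall>t \<in> transitions A. discount A t \<in> \<int>)"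

definition finite_words :: "'s set \<Rightarrow> 's list set" where
  "finite_words \<Sigma> = lists \<Sigma> - {[]}"

definition infinite_words :: "'s set \<Rightarrow> (nat \<Rightarrow> 's) set" where
  "infinite_words \<Sigma> = {w. range w \<subseteq> \<Sigma>}"

text \<open>A run on a given word is represented by its sequence of states.\<close>

definition fin_run :: "('s, 'q) nmda \<Rightarrow> 's list \<Rightarrow> 'q list \<Rightarrow> bool" where
  "fin_run A w p \<longleftrightarrow>
     length p = Suc (length w) \<and> p ! 0 \<in> initials A \<and>
     (\<forall>i < length w. (p ! i, w ! i, p ! Suc i) \<in> transitions A)"

definition inf_run :: "('s, 'q) nmda \<Rightarrow> (nat \<Rightarrow> 's) \<Rightarrow> (nat \<Rightarrow> 'q) \<Rightarrow> bool" where
  "inf_run A w p \<longleftrightarrow>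
     p 0 \<in> initials A \<and> (\<forall>i. (p i, w i, p (Suc i)) \<in> transitions A)"

definition discounted_weight ::
    "('s, 'q) nmda \<Rightarrow> (nat \<Rightarrow> 'q \<times> 's \<times> 'q) \<Rightarrow> nat \<Rightarrow> real" where
  "discounted_weight A t i =
     real_of_rat (weight A (t i)) * (\<Prod>j<i. 1 / real_of_rat (discount A (t j)))"

definition fin_run_value :: "('s, 'q) nmda \<Rightarrow> 's list \<Rightarrow> 'q list \<Rightarrow> real" where
  "fin_run_value A w p =
     (\<Sum>i<length w. discounted_weight A (\<lambda>i. (p ! i, w ! i, p ! Suc i)) i)"

text \<open>
  There are finitely many transitions, all with discount factor above 1, so the series below
  converges absolutely, and the set of values of the runs on an infinite word is bounded.
\<close>

definition inf_run_value :: "('s, 'q) nmda \<Rightarrow> (nat \<Rightarrow> 's) \<Rightarrow> (nat \<Rightarrow> 'q) \<Rightarrow> real" where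
  "inf_run_value A w p = (\<Sum>i. discounted_weight A (\<lambda>i. (p i, w i, p (Suc i))) i)"

definition fin_value :: "('s, 'q) nmda \<Rightarrow> 's list \<Rightarrow> real" where
  "fin_value A w = Inf {fin_run_value A w p | p. fin_run A w p}"

definition inf_value :: "('s, 'q) nmda \<Rightarrow> (nat \<Rightarrow> 's) \<Rightarrow> real" where
  "inf_value A w = Inf {inf_run_value A w p | p. inf_run A w p}"

text \<open>
  In a run \<open>p\<close> on \<open>u\<close>, the last transition is the one at index \<open>length u - 1\<close>.
\<close>

definition theta_nmda :: "'s set \<Rightarrow> ('s list \<Rightarrow> nat) \<Rightarrow> ('s, 'q) nmda \<Rightarrow> bool" where
  "theta_nmda \<Sigma> \<theta> A \<longleftrightarrow>
     integral_nmda A \<and> alphabet A = \<Sigma> \<and>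
     (\<forall>u \<in> finite_words \<Sigma>. \<forall>p. fin_run A u p \<longrightarrow>
        discount A (p ! (length u - 1), last u, p ! length u) = of_nat (\<theta> u))"

text \<open>
  State sets are finite, so up to renaming of states every automaton has states in \<^typ>\<open>nat\<close>;
  existential quantification over automata therefore uses this state type.
\<close>

definition choice_function :: "'s set \<Rightarrow> ('s list \<Rightarrow> nat) \<Rightarrow> bool" where
  "choice_function \<Sigma> \<theta> \<longleftrightarrow>
     (\<forall>u \<in> finite_words \<Sigma>. \<theta> u \<notin> {0, 1}) \<and>
     (\<exists>A :: ('s, nat) nmda. theta_nmda \<Sigma> \<theta> A)"

end

theory Submission imports Defs begin

text \<open>
  In a \<open>\<theta>\<close>-NMDA the discounting along a run depends only on the word, so the automaton can be
  determinized: it suffices to remember, for every state, the gap between the cheapest run to that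
  state and the cheapest run overall, scaled by the accumulated discount. Scaled gaps are multiples
  of a fixed rational, and since all discount factors are at least 2, gaps above a fixed bound never
  become relevant again, so finitely many gap vectors remain. Hence the increments of the value
  along a word, scaled in the same way, are computed by a finite deterministic machine. Such
  functions are closed under linear combinations and, by the same gap argument, under minima;
  finally \<open>max x y = x + y - min x y\<close>. The same automata work for infinite words, because the
  value of an infinite word is the limit of the values of its finite prefixes.
\<close>

section \<open>Functions computed by finite deterministic machines\<close>

text \<open>\<open>S u\<close> is the state of a deterministic machine after reading \<open>u\<close>.\<close>

definition finite_state :: "'s set \<Rightarrow> ('s list \<Rightarrow> 'b) \<Rightarrow> bool" where
  "finite_state \<Sigma> X \<longleftrightarrow>
     (\<exists>S :: 's list \<Rightarrow> nat. finite (S ` lists \<Sigma>) \<and>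
       (\<forall>u \<in> lists \<Sigma>. \<forall>v \<in> lists \<Sigma>. S u = S v \<longrightarrow>
          X u = X v \<and> (\<forall>a \<in> \<Sigma>. S (u @ [a]) = S (v @ [a]))))"

text \<open>A definition cannot quantify over types, so \<open>finite_state\<close> fixes machine
  states in \<open>nat\<close>. Any finite set of states embeds into \<open>nat\<close>, which
  allows pairs and sets as states below.\<close>

lemma finite_stateI:
  fixes S :: "'s list \<Rightarrow> 'z"
  assumes fin: "finite (S ` lists \<Sigma>)"
    and out: "\<And>u v. u \<in> lists \<Sigma> \<Longrightarrow> v \<in> lists \<Sigma> \<Longrightarrow> S u = S v \<Longrightarrow> X u = X v"
    and step: "\<And>u v a. u \<in> lists \<Sigma> \<Longrightarrow> v \<in> lists \<Sigma> \<Longrightarrow> a \<in> \<Sigma> \<Longrightarrow> S u = S v \<Longrightarrow>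
      S (u @ [a]) = S (v @ [a])"
  shows "finite_state \<Sigma> X"
proof -
  obtain f :: "'z \<Rightarrow> nat" where f: "inj_on f (S ` lists \<Sigma>)"
    using finite_imp_inj_to_nat_seg[OF fin] by blast
  have "finite ((f \<circ> S) ` lists \<Sigma>)"
    using fin by (metis finite_imageI image_comp)
  moreover have "X u = X v \<and> (\<forall>a \<in> \<Sigma>. (f \<circ> S) (u @ [a]) = (f \<circ> S) (v @ [a]))"
    if "u \<in> lists \<Sigma>" "v \<in> lists \<Sigma>" "(f \<circ> S) u = (f \<circ> S) v" for u v
  proof -
    have "S u = S v" using that f by (auto dest: inj_onD)
    then show ?thesis using out step that by (metis comp_apply)
  qed
  ultimately show ?thesis unfolding finite_state_def by blast
qed

lemma finite_state_finite_range:
  fixes X :: "'s list \<Rightarrow> 'b"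
  assumes "finite_state \<Sigma> X"
  shows "finite (X ` lists \<Sigma>)"
proof -
  obtain S :: "'s list \<Rightarrow> nat" where S: "finite (S ` lists \<Sigma>)"
    "\<And>u v. u \<in> lists \<Sigma> \<Longrightarrow> v \<in> lists \<Sigma> \<Longrightarrow> S u = S v \<Longrightarrow> X u = X v"
    using assms unfolding finite_state_def by blast
  have "X u = X (inv_into (lists \<Sigma>) S (S u))" if "u \<in> lists \<Sigma>" for u
    using that by (intro S(2)) (auto simp: inv_into_into f_inv_into_f simp del: in_lists_conv_set)
  then have "X ` lists \<Sigma> \<subseteq> (\<lambda>s. X (inv_into (lists \<Sigma>) S s)) ` (S ` lists \<Sigma>)"
    by (auto simp del: in_lists_conv_set)
  then show ?thesis using S(1) finite_surj by blast
qed

text \<open>Pairing the machine for \<open>Y\<close> with \<open>D\<close> itself gives a machine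
  whose state includes the output. Finiteness of the range of \<open>D\<close> is the one point the
  recursion cannot supply.\<close>

lemma finite_state_rec:
  fixes D :: "'s list \<Rightarrow> 'd"
  assumes Y: "finite_state \<Sigma> Y" and fin: "finite (D ` lists \<Sigma>)"
    and rec: "\<And>u a. u \<in> lists \<Sigma> \<Longrightarrow> a \<in> \<Sigma> \<Longrightarrow> D (u @ [a]) = h a (D u) (Y (u @ [a]))"
  shows "finite_state \<Sigma> D"
proof -
  obtain S :: "'s list \<Rightarrow> nat" where S: "finite (S ` lists \<Sigma>)"
    "\<And>u v. u \<in> lists \<Sigma> \<Longrightarrow> v \<in> lists \<Sigma> \<Longrightarrow> S u = S v \<Longrightarrow>
       Y u = Y v \<and> (\<forall>a \<in> \<Sigma>. S (u @ [a]) = S (v @ [a]))"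
    using Y unfolding finite_state_def by blast
  show ?thesis
  proof (rule finite_stateI[where S = "\<lambda>u. (S u, D u)"])
    have "(\<lambda>u. (S u, D u)) ` lists \<Sigma> \<subseteq> S ` lists \<Sigma> \<times> D ` lists \<Sigma>" by blast
    then show "finite ((\<lambda>u. (S u, D u)) ` lists \<Sigma>)"
      using S(1) fin by (meson finite_SigmaI finite_subset)
  next
    fix u v a assume *: "u \<in> lists \<Sigma>" "v \<in> lists \<Sigma>" "a \<in> \<Sigma>" "(S u, D u) = (S v, D v)"
    have "S (u @ [a]) = S (v @ [a])" using S(2)[of u v] * by blast
    \<comment> \<open>The recursion reads \<open>Y\<close> on the extended word, so the output is
      taken after the machine for \<open>Y\<close> has moved.\<close>
    moreover have "Y (u @ [a]) = Y (v @ [a])"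
      using S(2)[of "u @ [a]" "v @ [a]"] * calculation by simp
    ultimately show "(S (u @ [a]), D (u @ [a])) = (S (v @ [a]), D (v @ [a]))"
      using rec * by simp
  qed simp
qed

lemma finite_state_pair:
  fixes X :: "'s list \<Rightarrow> 'b"
  assumes X: "finite_state \<Sigma> X" and Y: "finite_state \<Sigma> Y"
  shows "finite_state \<Sigma> (\<lambda>u. (X u, Y u))"
proof -
  obtain S :: "'s list \<Rightarrow> nat" where S: "finite (S ` lists \<Sigma>)"
    "\<And>u v. u \<in> lists \<Sigma> \<Longrightarrow> v \<in> lists \<Sigma> \<Longrightarrow> S u = S v \<Longrightarrow>
       X u = X v \<and> (\<forall>a \<in> \<Sigma>. S (u @ [a]) = S (v @ [a]))"
    using X unfolding finite_state_def by blast
  obtain R :: "'s list \<Rightarrow> nat" where R: "finite (R ` lists \<Sigma>)"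
    "\<And>u v. u \<in> lists \<Sigma> \<Longrightarrow> v \<in> lists \<Sigma> \<Longrightarrow> R u = R v \<Longrightarrow>
       Y u = Y v \<and> (\<forall>a \<in> \<Sigma>. R (u @ [a]) = R (v @ [a]))"
    using Y unfolding finite_state_def by blast
  show ?thesis
  proof (rule finite_stateI[where S = "\<lambda>u. (S u, R u)"])
    have "(\<lambda>u. (S u, R u)) ` lists \<Sigma> \<subseteq> S ` lists \<Sigma> \<times> R ` lists \<Sigma>" by blast
    then show "finite ((\<lambda>u. (S u, R u)) ` lists \<Sigma>)"
      using S(1) R(1) by (meson finite_SigmaI finite_subset)
  qed (use S(2) R(2) in blast)+
qed

lemma finite_state_comp:
  assumes "finite_state \<Sigma> X"
  shows "finite_state \<Sigma> (\<lambda>u. f (X u))"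
  using assms unfolding finite_state_def by metis

text \<open>Lists are built from the front while words grow at the back, hence the recursion runs
  over the reversed word. The step function receives the whole extended word and not only its last
  letter.\<close>

lemma ex_snoc_rec:
  "\<exists>D. D [] = d0 \<and> (\<forall>u a. D (u @ [a]) = f (D u) (u @ [a]))"
proof (intro exI conjI allI)
  let ?D = "\<lambda>u. rec_list d0 (\<lambda>a v d. f d (rev (a # v))) (rev u)"
  show "?D [] = d0" by simp
  show "?D (u @ [a]) = f (?D u) (u @ [a])" for u a by simp
qed

section \<open>Accumulated discounts and discounted sums with machine-computed coefficients\<close>

text \<open>In a \<theta>-NMDA, the reciprocal is the factor applied to the weight of the transition
  taken right after \<open>u\<close>, whatever the run.\<close>

definition total_discount :: "('s list \<Rightarrow> nat) \<Rightarrow> 's list \<Rightarrow> real" where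
  "total_discount \<theta> u = (\<Prod>j<length u. real (\<theta> (take (Suc j) u)))"

lemma total_discount_Nil [simp]: "total_discount \<theta> [] = 1"
  by (simp add: total_discount_def)

lemma total_discount_snoc [simp]:
  "total_discount \<theta> (u @ [a]) = total_discount \<theta> u * real (\<theta> (u @ [a]))"
  by (simp add: total_discount_def)

lemma total_discount_ge:
  assumes "\<And>u. u \<in> finite_words \<Sigma> \<Longrightarrow> 2 \<le> \<theta> u" and "u \<in> lists \<Sigma>"
  shows "2 ^ length u \<le> total_discount \<theta> u"
  using assms(2)
proof (induction u rule: rev_induct)
  case (snoc a u)
  then have "2 \<le> \<theta> (u @ [a])" by (intro assms(1)) (auto simp: finite_words_def)
  then have "2 ^ length u * 2 \<le> total_discount \<theta> u * real (\<theta> (u @ [a]))"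
    using snoc by (intro mult_mono) (auto intro: order_trans[rotated])
  then show ?case by (simp add: mult.commute)
qed simp

lemma total_discount_pos:
  assumes "\<And>u. u \<in> finite_words \<Sigma> \<Longrightarrow> 2 \<le> \<theta> u" and "u \<in> lists \<Sigma>"
  shows "0 < total_discount \<theta> u"
  using total_discount_ge[OF assms] by (meson less_le_trans zero_less_numeral zero_less_power)

text \<open>These are the value functions of deterministic \<theta>-NMDAs, with \<open>x\<close>
  giving the weights. The divisor belongs to \<open>u\<close> and not to \<open>u @ [a]\<close>,
  because the discount factor of a transition affects only later weights.\<close>

definition realizable :: "'s set \<Rightarrow> ('s list \<Rightarrow> nat) \<Rightarrow> ('s list \<Rightarrow> real) \<Rightarrow> bool" where
  "realizable \<Sigma> \<theta> F \<longleftrightarrow> F [] = 0 \<and>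
     (\<exists>x :: 's list \<Rightarrow> rat. finite_state \<Sigma> x \<and>
       (\<forall>u \<in> lists \<Sigma>. \<forall>a \<in> \<Sigma>.
          F (u @ [a]) = F u + real_of_rat (x (u @ [a])) / total_discount \<theta> u))"

text \<open>Both increments have the same divisor since both functions are discounted by the same
  \<theta>; the coefficients therefore combine pointwise.\<close>

lemma realizable_linear_combination:
  assumes "realizable \<Sigma> \<theta> F" and "realizable \<Sigma> \<theta> G"
  shows "realizable \<Sigma> \<theta> (\<lambda>u. real_of_rat b * F u + real_of_rat c * G u)"
proof -
  obtain x y where x: "F [] = 0" "finite_state \<Sigma> x"
      "\<forall>u \<in> lists \<Sigma>. \<forall>a \<in> \<Sigma>. F (u @ [a]) = F u + real_of_rat (x (u @ [a])) / total_discount \<theta> u"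
    and y: "G [] = 0" "finite_state \<Sigma> y"
      "\<forall>u \<in> lists \<Sigma>. \<forall>a \<in> \<Sigma>. G (u @ [a]) = G u + real_of_rat (y (u @ [a])) / total_discount \<theta> u"
    using assms unfolding realizable_def by blast
  have "finite_state \<Sigma> (\<lambda>u. b * x u + c * y u)"
    using finite_state_comp[OF finite_state_pair[OF x(2) y(2)], of "\<lambda>(s, t). b * s + c * t"] by simp
  then show ?thesis unfolding realizable_def using x y
    by (intro conjI exI[of _ "\<lambda>u. b * x u + c * y u"])
       (auto simp: of_rat_add of_rat_mult algebra_simps add_divide_distrib)
qed

section \<open>Rationals with a common denominator\<close>

lemma finite_rat_common_denominator:
  assumes "finite (R :: rat set)"
  shows "\<exists>m :: nat. m > 0 \<and> (\<forall>r \<in> R. of_nat m * r \<in> \<int>)"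
  using assms
proof induction
  case empty
  then show ?case by (intro exI[of _ 1]) simp
next
  case (insert r R)
  then obtain m :: nat where m: "m > 0" "\<forall>r \<in> R. of_nat m * r \<in> \<int>" by blast
  obtain i j where ij: "quotient_of r = (i, j)" by (cases "quotient_of r")
  then have j: "j > 0" "r = of_int i / of_int j"
    using quotient_of_denom_pos quotient_of_div by blast+
  have "of_nat (m * nat j) * s \<in> \<int>" if "s \<in> insert r R" for s
  proof (cases "s = r")
    case True
    then have "of_nat (m * nat j) * s = of_int (int m * i)" using j by simp
    then show ?thesis by (metis Ints_of_int)
  next
    case False
    then have "of_nat (m * nat j) * s = of_nat (nat j) * (of_nat m * s)" by simp
    then show ?thesis using m that False by (metis Ints_mult Ints_of_nat insertE)
  qed
  then show ?case using m j by (intro exI[of _ "m * nat j"]) auto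
qed

lemma finite_bounded_multiples:
  fixes C :: rat
  assumes "m > (0 :: nat)"
  shows "finite {y. of_nat m * y \<in> \<int> \<and> \<bar>y\<bar> \<le> C}"
proof -
  have "y \<in> (\<lambda>k. of_int k / of_nat m) ` {- \<lceil>of_nat m * C\<rceil> .. \<lceil>of_nat m * C\<rceil>}"
    if "of_nat m * y \<in> \<int>" "\<bar>y\<bar> \<le> C" for y
  proof -
    obtain k where k: "of_nat m * y = of_int k" using \<open>of_nat m * y \<in> \<int>\<close> Ints_cases by blast
    have "\<bar>of_int k :: rat\<bar> \<le> of_nat m * C"
      unfolding k[symmetric] abs_mult using that by (simp add: mult_left_mono)
    also have "\<dots> \<le> of_int \<lceil>of_nat m * C\<rceil>" by simp
    finally have "\<bar>k\<bar> \<le> \<lceil>of_nat m * C\<rceil>" by (metis of_int_abs of_int_le_iff)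
    moreover have "y = of_int k / of_nat m" using k assms by (simp add: field_simps)
    ultimately show ?thesis by (auto simp: abs_le_iff)
  qed
  then show ?thesis by (blast intro: finite_subset[OF _ finite_imageI[OF finite_atLeastAtMost_int]])
qed

section \<open>Capped gap vectors and their update\<close>

text \<open>
  A triple \<open>(q, q', r)\<close> is a transition of weight \<open>r\<close>. Gaps are capped at \<open>C\<close>; the value \<open>C\<close>
  also stands for an infinite gap.
\<close>

definition pre_gap :: "rat \<Rightarrow> ('q \<times> 'q \<times> rat) set \<Rightarrow> ('q \<Rightarrow> rat) \<Rightarrow> 'q \<Rightarrow> rat" where
  "pre_gap C t g q' = Min (insert C ((\<lambda>(q, _, r). g q + r) ` {e \<in> t. fst (snd e) = q'}))"

text \<open>The change of the minimal cost caused by one letter, measured in the unit of the word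
  before that letter. It becomes the coefficient of the resulting discounted sum.\<close>

definition gap_offset :: "rat \<Rightarrow> 'q set \<Rightarrow> ('q \<times> 'q \<times> rat) set \<Rightarrow> ('q \<Rightarrow> rat) \<Rightarrow> rat" where
  "gap_offset C Q t g = Min (pre_gap C t g ` Q)"

text \<open>Subtracting the offset brings the smallest gap to 0, and the factor \<open>d\<close>
  converts to the unit of the longer word. The value 0 outside \<open>Q\<close> makes a vector
  determined by its finitely many entries on \<open>Q\<close>.\<close>

definition next_gap ::
    "rat \<Rightarrow> 'q set \<Rightarrow> ('q \<times> 'q \<times> rat) set \<Rightarrow> nat \<Rightarrow> ('q \<Rightarrow> rat) \<Rightarrow> 'q \<Rightarrow> rat" where
  "next_gap C Q t d g q' =
     (if q' \<in> Q then min C (of_nat d * (pre_gap C t g q' - gap_offset C Q t g)) else 0)"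

text \<open>Multiples of \<open>1 / m\<close> between 0 and \<open>C\<close> leave finitely many
  vectors, and the zero entry marks a state reached at minimal cost.\<close>

definition gaps :: "rat \<Rightarrow> nat \<Rightarrow> 'q set \<Rightarrow> ('q \<Rightarrow> rat) \<Rightarrow> bool" where
  "gaps C m Q g \<longleftrightarrow>
     (\<forall>q. q \<in> Q \<longrightarrow> of_nat m * g q \<in> \<int> \<and> 0 \<le> g q \<and> g q \<le> C) \<and>
     (\<forall>q. q \<notin> Q \<longrightarrow> g q = 0) \<and> (\<exists>q \<in> Q. g q = 0)"

lemma pre_gap_le:
  assumes "finite t" "(q, q', r) \<in> t"
  shows "pre_gap C t g q' \<le> g q + r"
  unfolding pre_gap_def using assms by (intro Min_le) (auto intro: rev_image_eqI)

lemma pre_gap_cases: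
  assumes "finite t"
  obtains "pre_gap C t g q' = C" | q r where "(q, q', r) \<in> t" "pre_gap C t g q' = g q + r"
proof -
  have "pre_gap C t g q' \<in> insert C ((\<lambda>(q, _, r). g q + r) ` {e \<in> t. fst (snd e) = q'})"
    unfolding pre_gap_def using assms by (intro Min_in) auto
  then show thesis using that by auto
qed

lemma gap_offset_le:
  assumes "finite Q" "q \<in> Q"
  shows "gap_offset C Q t g \<le> pre_gap C t g q"
  unfolding gap_offset_def using assms by simp

lemma gap_offset_attained:
  assumes "finite Q" "Q \<noteq> {}"
  obtains q where "q \<in> Q" "pre_gap C t g q = gap_offset C Q t g"
  unfolding gap_offset_def using Min_in[of "pre_gap C t g ` Q"] assms by fastforce

text \<open>From a state with gap 0 some transition leaves with weight at most \<open>M\<close>,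
  which bounds the offset above. Gaps and \<open>C\<close> are nonnegative, so no candidate lies
  below \<open>- M\<close>.\<close>

lemma gap_offset_bounds:
  fixes C M :: rat
  assumes "finite Q" "finite t" "t \<subseteq> Q \<times> Q \<times> {r. \<bar>r\<bar> \<le> M}" and "0 \<le> M" "0 \<le> C"
    and serial: "\<And>q. q \<in> Q \<Longrightarrow> \<exists>q' r. (q, q', r) \<in> t"
    and g: "gaps C m Q g"
  shows "\<bar>gap_offset C Q t g\<bar> \<le> M"
proof -
  obtain q where q: "q \<in> Q" "g q = 0" using g unfolding gaps_def by blast
  obtain q' r where t: "(q, q', r) \<in> t" using serial q by blast
  then have r: "q' \<in> Q" "\<bar>r\<bar> \<le> M" using assms by auto
  have "gap_offset C Q t g \<le> g q + r"
    using gap_offset_le[OF \<open>finite Q\<close> r(1)] pre_gap_le[OF \<open>finite t\<close> t] by (meson order_trans)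
  then have "gap_offset C Q t g \<le> M" using q r by simp
  moreover obtain p where p: "p \<in> Q" "pre_gap C t g p = gap_offset C Q t g"
    using gap_offset_attained assms q by (metis empty_iff)
  have "- M \<le> pre_gap C t g p"
  proof (cases rule: pre_gap_cases[OF \<open>finite t\<close>, of C g p])
    case (2 q r)
    then have "q \<in> Q" "\<bar>r\<bar> \<le> M" using assms by auto
    moreover from this have "0 \<le> g q" using g unfolding gaps_def by blast
    ultimately show ?thesis using 2 by simp
  qed (use assms in simp)
  ultimately show ?thesis using p by simp
qed

lemma pre_gap_multiple:
  assumes "finite t" "t \<subseteq> Q \<times> Q \<times> {r. of_nat m * r \<in> \<int>}" "gaps C m Q g" "of_nat m * C \<in> \<int>"
  shows "of_nat m * pre_gap C t g q' \<in> \<int>"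
proof (cases rule: pre_gap_cases[OF \<open>finite t\<close>, of C g q'])
  case (2 q r)
  then have "q \<in> Q" "of_nat m * r \<in> \<int>" using assms by auto
  moreover from this have "of_nat m * g q \<in> \<int>" using assms unfolding gaps_def by blast
  ultimately show ?thesis using 2 by (simp add: distrib_left)
qed (use assms in simp)

lemma gap_offset_multiple:
  assumes "finite t" "t \<subseteq> Q \<times> Q \<times> {r. of_nat m * r \<in> \<int>}" "gaps C m Q g" "of_nat m * C \<in> \<int>"
    and "finite Q"
  shows "of_nat m * gap_offset C Q t g \<in> \<int>"
proof -
  have "Q \<noteq> {}" using assms(3) unfolding gaps_def by blast
  then show ?thesis using gap_offset_attained pre_gap_multiple assms by metis
qed

text \<open>Integrality of the discount factors enters here: multiplying by the natural number
  \<open>d\<close> keeps the denominator \<open>m\<close>, whereas a fractional factor could make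
  denominators grow. The state attaining the offset receives gap 0.\<close>

lemma gaps_next_gap:
  fixes C :: rat
  assumes "finite t" "t \<subseteq> Q \<times> Q \<times> {r. of_nat m * r \<in> \<int>}" "gaps C m Q g" "of_nat m * C \<in> \<int>"
    and "finite Q" "0 \<le> C"
  shows "gaps C m Q (next_gap C Q t d g)"
  unfolding gaps_def
proof (intro conjI allI impI)
  have "Q \<noteq> {}" using assms(3) unfolding gaps_def by blast
  then obtain p where "p \<in> Q" "pre_gap C t g p = gap_offset C Q t g"
    using gap_offset_attained assms by metis
  then show "\<exists>q \<in> Q. next_gap C Q t d g q = 0"
    using assms by (intro bexI[of _ p]) (auto simp: next_gap_def)
next
  fix q assume q: "q \<in> Q"
  have "of_nat d * (of_nat m * pre_gap C t g q - of_nat m * gap_offset C Q t g) \<in> \<int>"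
    using pre_gap_multiple[OF assms(1-4)] gap_offset_multiple[OF assms(1-5)] by simp
  then have "of_nat m * (of_nat d * (pre_gap C t g q - gap_offset C Q t g)) \<in> \<int>"
    by (simp add: algebra_simps)
  then show "of_nat m * next_gap C Q t d g q \<in> \<int>"
    using q assms(4) by (simp add: next_gap_def min_def)
  show "0 \<le> next_gap C Q t d g q" "next_gap C Q t d g q \<le> C"
    using q assms gap_offset_le[OF \<open>finite Q\<close> q, of C t g] by (auto simp: next_gap_def)
qed (simp add: next_gap_def)

text \<open>An uncapped gap comes from an uncapped gap. A new gap below \<open>C = 4 * M\<close> is
  at least twice \<open>pre_gap\<close> minus the offset, and the offset is at most
  \<open>M\<close>, so \<open>pre_gap\<close> is below \<open>3 * M\<close>. It is therefore not the
  cap but some \<open>g q + r\<close>, and \<open>r \<ge> - M\<close> gives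
  \<open>g q < 4 * M\<close>. The constant solves \<open>C / 2 + M + M = C\<close>.\<close>

lemma next_gap_attained:
  fixes M :: rat
  assumes "finite Q" "finite t" "t \<subseteq> Q \<times> Q \<times> {r. \<bar>r\<bar> \<le> M}" "0 < M" "2 \<le> d"
    and "\<And>q. q \<in> Q \<Longrightarrow> \<exists>q' r. (q, q', r) \<in> t"
    and "gaps (4 * M) m Q g" and q': "q' \<in> Q" and less: "next_gap (4 * M) Q t d g q' < 4 * M"
  shows "\<exists>q r. (q, q', r) \<in> t \<and> g q < 4 * M \<and>
    next_gap (4 * M) Q t d g q' = of_nat d * (g q + r - gap_offset (4 * M) Q t g)"
proof -
  let ?h = "pre_gap (4 * M) t g q'" and ?x = "gap_offset (4 * M) Q t g"
  have x: "\<bar>?x\<bar> \<le> M" using gap_offset_bounds[of Q t M "4 * M" m g] assms by auto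
  have "2 * (?h - ?x) \<le> of_nat d * (?h - ?x)"
    using gap_offset_le[OF \<open>finite Q\<close> q', of "4 * M" t g] assms(5)
    by (intro mult_right_mono) (auto simp: numeral_le_real_of_nat_iff dest: of_nat_mono[where 'a = rat])
  moreover have eq: "next_gap (4 * M) Q t d g q' = of_nat d * (?h - ?x)"
    using less q' by (auto simp: next_gap_def min_def split: if_splits)
  ultimately have h: "?h < 3 * M" using less x by simp
  show ?thesis
  proof (cases rule: pre_gap_cases[OF \<open>finite t\<close>, of "4 * M" g q'])
    case (2 q r)
    then have "\<bar>r\<bar> \<le> M" using assms by auto
    then show ?thesis using 2 h eq by (intro exI[of _ q] exI[of _ r]) auto
  qed (use h assms in simp)
qed

text \<open>Capping only decreases a gap, so undoing the shift and the rescaling still yields a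
  lower bound.\<close>

lemma pre_gap_le_next_gap:
  fixes C :: rat
  assumes "q' \<in> Q" "0 < d"
  shows "gap_offset C Q t g + next_gap C Q t d g q' / of_nat d \<le> pre_gap C t g q'"
proof -
  have "next_gap C Q t d g q' \<le> of_nat d * (pre_gap C t g q' - gap_offset C Q t g)"
    using assms by (simp add: next_gap_def)
  then show ?thesis using assms by (simp add: field_simps)
qed

section \<open>The minimal cost of runs as a discounted sum\<close>

text \<open>
  \<open>K u q\<close> is the set of costs of the runs on \<open>u\<close> that end in \<open>q\<close>.  A run whose cost exceeds the
  minimum over \<open>u\<close> by at least \<open>4 M\<close> divided by the total discount of \<open>u\<close> cannot become optimal
  again, since all further weights are at most \<open>M\<close> and the discount factors are at least 2.
\<close>

lemma realizable_min_cost: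
  fixes Q :: "'q set" and T :: "'s list \<Rightarrow> ('q \<times> 'q \<times> rat) set" and K :: "'s list \<Rightarrow> 'q \<Rightarrow> real set"
  assumes \<theta>_ge: "\<And>u. u \<in> finite_words \<Sigma> \<Longrightarrow> 2 \<le> \<theta> u"
    and fs_\<theta>: "finite_state \<Sigma> \<theta>" and fs_T: "finite_state \<Sigma> T"
    and finQ: "finite Q"
    and fin_T: "\<And>u. u \<in> lists \<Sigma> \<Longrightarrow> finite (T u)"
    and T_sub: "\<And>u. u \<in> lists \<Sigma> \<Longrightarrow> T u \<subseteq> Q \<times> Q \<times> UNIV"
    and serial: "\<And>u a q. u \<in> lists \<Sigma> \<Longrightarrow> a \<in> \<Sigma> \<Longrightarrow> q \<in> Q \<Longrightarrow> \<exists>q' r. (q, q', r) \<in> T (u @ [a])"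
    and I: "I \<subseteq> Q" "I \<noteq> {}"
    and K_Nil: "\<And>q. K [] q = (if q \<in> I then {0} else {})"
    and K_snoc: "\<And>u a q'. u \<in> lists \<Sigma> \<Longrightarrow> a \<in> \<Sigma> \<Longrightarrow>
      K (u @ [a]) q' =
        {k + real_of_rat r / total_discount \<theta> u | q k r. (q, q', r) \<in> T (u @ [a]) \<and> k \<in> K u q}"
  shows "realizable \<Sigma> \<theta> (\<lambda>u. Inf (\<Union>q \<in> Q. K u q))"
proof -
  \<comment> \<open>Only finitely many edge sets occur along words and each is finite, so the set
    \<open>R\<close> of all weights is finite.\<close>
  define R where "R = (\<lambda>(q, q', r). r) ` (\<Union>u \<in> lists \<Sigma>. T u)"
  have "finite (\<Union>(T ` lists \<Sigma>))"
    using finite_state_finite_range[OF fs_T] fin_T by (intro finite_Union) auto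
  then have finR: "finite R" unfolding R_def by simp
  obtain m :: nat where m: "m > 0" "\<And>r. r \<in> R \<Longrightarrow> of_nat m * r \<in> \<int>"
    using finite_rat_common_denominator[OF finR] by blast
  \<comment> \<open>The ceilings make \<open>M\<close> an integer, so that \<open>C\<close> is a
    multiple of \<open>1 / m\<close>; inserting 1 makes it positive.\<close>
  define M :: rat where "M = of_int (Max (insert 1 ((\<lambda>r. \<lceil>\<bar>r\<bar>\<rceil>) ` R)))"
  have M_ge: "1 \<le> M" unfolding M_def using finR by simp
  then have M_pos: "0 < M" by simp
  have M: "\<bar>r\<bar> \<le> M" if "r \<in> R" for r
  proof -
    have "\<lceil>\<bar>r\<bar>\<rceil> \<le> Max (insert 1 ((\<lambda>r. \<lceil>\<bar>r\<bar>\<rceil>) ` R))" using finR that by (intro Max_ge) auto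
    then have "of_int \<lceil>\<bar>r\<bar>\<rceil> \<le> M" unfolding M_def of_int_le_iff .
    then show ?thesis by (meson le_of_int_ceiling order_trans)
  qed
  define C where "C = 4 * M"
  have C: "0 \<le> C" "0 < C" "of_nat m * C \<in> \<int>" using M_ge by (auto simp: C_def M_def)
  define E where "E u = (T u, \<theta> u)" for u
  \<comment> \<open>No run on the empty word ends in a noninitial state, which is expressed by the
    cap \<open>C\<close>.\<close>
  define g0 :: "'q \<Rightarrow> rat" where "g0 q = (if q \<in> Q - I then C else 0)" for q
  \<comment> \<open>The offset depends on the gaps before the letter, while a machine outputs from
    its state after the letter; hence it is stored beside the new gaps. At the empty word the offset
    0 is a default within \<open>x_bound\<close>.\<close>
  obtain D where D0: "D [] = (g0, 0)"
    and D: "\<And>u a. D (u @ [a]) =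
      (next_gap C Q (T (u @ [a])) (\<theta> (u @ [a])) (fst (D u)), gap_offset C Q (T (u @ [a])) (fst (D u)))"
    using ex_snoc_rec[of "(g0, 0)"
        "\<lambda>d v. (next_gap C Q (T v) (\<theta> v) (fst d), gap_offset C Q (T v) (fst d))"] by blast
  define g where "g u = fst (D u)" for u
  define x where "x u = snd (D u)" for u
  have g_snoc: "g (u @ [a]) = next_gap C Q (T (u @ [a])) (\<theta> (u @ [a])) (g u)" for u a
    by (simp add: g_def D)
  have x_snoc: "x (u @ [a]) = gap_offset C Q (T (u @ [a])) (g u)" for u a
    by (simp add: g_def x_def D)
  have T_R: "T u \<subseteq> Q \<times> Q \<times> R" if "u \<in> lists \<Sigma>" for u
    using T_sub[OF that] that unfolding R_def by force
  have T_M: "T u \<subseteq> Q \<times> Q \<times> {r. \<bar>r\<bar> \<le> M}" and T_m: "T u \<subseteq> Q \<times> Q \<times> {r. of_nat m * r \<in> \<int>}"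
    if "u \<in> lists \<Sigma>" for u
    using T_R[OF that] M m(2) by blast+
  have gaps: "gaps C m Q (g u)" if "u \<in> lists \<Sigma>" for u
    using that
  proof (induction u rule: rev_induct)
    case Nil
    show ?case using I C by (auto simp: gaps_def g_def D0 g0_def)
  next
    case (snoc a u)
    then have "T (u @ [a]) \<subseteq> Q \<times> Q \<times> {r. of_nat m * r \<in> \<int>}" "finite (T (u @ [a]))"
      by (intro T_m fin_T; simp)+
    then show ?case unfolding g_snoc using snoc C finQ by (intro gaps_next_gap) auto
  qed
  have x_bound: "of_nat m * x u \<in> \<int> \<and> \<bar>x u\<bar> \<le> M" if "u \<in> lists \<Sigma>" for u
  proof (cases u rule: rev_cases)
    case Nil
    then show ?thesis using M_ge by (simp add: x_def D0)
  next
    case (snoc v a)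
    then have v: "v \<in> lists \<Sigma>" "a \<in> \<Sigma>" using that by auto
    show ?thesis unfolding snoc x_snoc
      using gap_offset_bounds[of Q "T u" M C m "g v"] gap_offset_multiple[of "T u" Q m C "g v"]
        serial[OF v] T_m[OF that] T_M[OF that] fin_T[OF that] gaps[OF v(1)] C M_ge finQ
      unfolding snoc by auto
  qed
  have fs_D: "finite_state \<Sigma> D"
  proof (rule finite_state_rec[where Y = E and
        h = "\<lambda>_ d (t, n). (next_gap C Q t n (fst d), gap_offset C Q t (fst d))"])
    show "finite_state \<Sigma> E" using finite_state_pair[OF fs_T fs_\<theta>] by (simp add: E_def[abs_def])
    let ?Y = "\<lambda>C. {y :: rat. of_nat m * y \<in> \<int> \<and> \<bar>y\<bar> \<le> C}"
    \<comment> \<open>Gap vectors take finitely many values on \<open>Q\<close> and vanish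
      elsewhere, and offsets are multiples of \<open>1 / m\<close> bounded by
      \<open>M\<close>.\<close>
    have "D ` lists \<Sigma> \<subseteq> {f. \<forall>q. (q \<in> Q \<longrightarrow> f q \<in> ?Y C) \<and> (q \<notin> Q \<longrightarrow> f q = 0)} \<times> ?Y M"
    proof (intro image_subsetI)
      fix u assume u: "u \<in> lists \<Sigma>"
      have "g u \<in> {f. \<forall>q. (q \<in> Q \<longrightarrow> f q \<in> ?Y C) \<and> (q \<notin> Q \<longrightarrow> f q = 0)}"
        using gaps[OF u] unfolding gaps_def by simp
      moreover have "x u \<in> ?Y M" using x_bound[OF u] by simp
      ultimately show "D u \<in> {f. \<forall>q. (q \<in> Q \<longrightarrow> f q \<in> ?Y C) \<and> (q \<notin> Q \<longrightarrow> f q = 0)} \<times> ?Y M"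
        unfolding g_def x_def mem_Times_iff by simp
    qed
    moreover have "finite ({f. \<forall>q. (q \<in> Q \<longrightarrow> f q \<in> ?Y C) \<and> (q \<notin> Q \<longrightarrow> f q = 0)} \<times> ?Y M)"
      using finQ finite_bounded_multiples[OF m(1)]
      by (intro finite_cartesian_product finite_set_of_finite_funs)
    ultimately show "finite (D ` lists \<Sigma>)" by (rule finite_subset)
  qed (simp add: D E_def)
  \<comment> \<open>\<open>V\<close> sums the discounted offsets. Since the recursion passes the
    extended word, \<open>butlast\<close> recovers the word whose discount is the divisor.\<close>
  obtain V :: "'s list \<Rightarrow> real" where V0: "V [] = 0" and V_rec:
    "\<And>u a. V (u @ [a]) = V u + real_of_rat (x (u @ [a])) / total_discount \<theta> (butlast (u @ [a]))"
    using ex_snoc_rec[of 0 "\<lambda>d v. d + real_of_rat (x v) / total_discount \<theta> (butlast v)"] by blast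
  have V: "V (u @ [a]) = V u + real_of_rat (x (u @ [a])) / total_discount \<theta> u" for u a
    using V_rec[of u a] by simp
  \<comment> \<open>Every gap gives a lower bound on the costs of runs ending in \<open>q\<close>; a
    gap below \<open>C\<close> is moreover exact, being realized by a run. At the cap there may be
    no run at all.\<close>
  have bounds: "(\<forall>q \<in> Q. \<forall>k \<in> K u q. V u + real_of_rat (g u q) / total_discount \<theta> u \<le> k) \<and>
      (\<forall>q \<in> Q. g u q < C \<longrightarrow> V u + real_of_rat (g u q) / total_discount \<theta> u \<in> K u q)"
    if "u \<in> lists \<Sigma>" for u
    using that
  proof (induction u rule: rev_induct)
    case Nil
    then show ?case using I by (auto simp: K_Nil V0 g_def D0 g0_def)
  next
    case (snoc a u)
    then have u: "u \<in> lists \<Sigma>" "a \<in> \<Sigma>" "u @ [a] \<in> lists \<Sigma>" by auto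
    define t d P where "t = T (u @ [a])" and "d = \<theta> (u @ [a])" and "P = total_discount \<theta> u"
    have t: "finite t" "t \<subseteq> Q \<times> Q \<times> {r. \<bar>r\<bar> \<le> M}"
      using fin_T[OF u(3)] T_M[OF u(3)] by (auto simp: t_def)
    have d: "2 \<le> d" using u(3) by (auto simp: d_def finite_words_def intro!: \<theta>_ge)
    have P: "0 < P" using total_discount_pos[of \<Sigma> \<theta> u, OF \<theta>_ge u(1)] by (simp add: P_def)
    have td: "total_discount \<theta> (u @ [a]) = P * real d" by (simp add: P_def d_def)
    have gs: "g (u @ [a]) = next_gap C Q t d (g u)" and xs: "x (u @ [a]) = gap_offset C Q t (g u)"
      by (simp_all add: g_snoc x_snoc t_def d_def)
    \<comment> \<open>Dividing a new gap by \<open>d\<close> returns to the unit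
      \<open>1 / P\<close> of the shorter word, where it can be compared with
      \<open>g u q + r\<close>.\<close>
    have eq: "V (u @ [a]) + real_of_rat y / total_discount \<theta> (u @ [a]) =
        V u + real_of_rat (x (u @ [a]) + y / of_nat d) / P" for y
      unfolding V td P_def[symmetric] by (simp add: of_rat_add of_rat_divide add_divide_distrib mult.commute)
    have "V (u @ [a]) + real_of_rat (g (u @ [a]) q') / total_discount \<theta> (u @ [a]) \<le> k'"
      if q': "q' \<in> Q" and k': "k' \<in> K (u @ [a]) q'" for q' k'
    proof -
      obtain q k r where k: "(q, q', r) \<in> t" "k \<in> K u q" "k' = k + real_of_rat r / P"
        using k' K_snoc[OF u(1,2)] unfolding t_def P_def by blast
      have "x (u @ [a]) + g (u @ [a]) q' / of_nat d \<le> g u q + r"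
        using pre_gap_le_next_gap[OF q', of d C t "g u"] pre_gap_le[OF t(1) k(1), of C "g u"] d
        unfolding gs xs by linarith
      then have "V u + real_of_rat (x (u @ [a]) + g (u @ [a]) q' / of_nat d) / P
          \<le> V u + real_of_rat (g u q + r) / P"
        using P by (intro add_left_mono divide_right_mono) (auto simp: of_rat_less_eq)
      also have "\<dots> = V u + real_of_rat (g u q) / P + real_of_rat r / P"
        by (simp add: of_rat_add add_divide_distrib)
      also have "\<dots> \<le> k'"
        using snoc.IH[OF u(1)] k t(2) unfolding k(3) P_def by auto
      finally show ?thesis unfolding eq .
    qed
    moreover have "V (u @ [a]) + real_of_rat (g (u @ [a]) q') / total_discount \<theta> (u @ [a]) \<in> K (u @ [a]) q'"
      if q': "q' \<in> Q" and less: "g (u @ [a]) q' < C" for q'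
    proof -
      obtain q r where q: "(q, q', r) \<in> t" "g u q < C"
        "g (u @ [a]) q' = of_nat d * (g u q + r - x (u @ [a]))"
        using next_gap_attained[OF finQ t M_pos d serial[OF u(1,2), folded t_def]
            gaps[OF u(1), unfolded C_def] q' less[unfolded gs C_def]]
        unfolding gs xs C_def by blast
      then have "x (u @ [a]) + g (u @ [a]) q' / of_nat d = g u q + r" using d by simp
      then have "V (u @ [a]) + real_of_rat (g (u @ [a]) q') / total_discount \<theta> (u @ [a]) =
          (V u + real_of_rat (g u q) / P) + real_of_rat r / P"
        unfolding eq by (simp add: of_rat_add add_divide_distrib)
      moreover have "V u + real_of_rat (g u q) / P \<in> K u q"
        using snoc.IH[OF u(1)] q t(2) unfolding P_def by auto
      ultimately show ?thesis
        using q(1) unfolding K_snoc[OF u(1,2)] t_def P_def by blast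
    qed
    ultimately show ?case by blast
  qed
  \<comment> \<open>A state with gap 0 is below the cap, so \<open>V u\<close> is the cost of a run;
    nonnegative gaps make it a lower bound.\<close>
  have Inf_eq: "Inf (\<Union>q \<in> Q. K u q) = V u" if u: "u \<in> lists \<Sigma>" for u
  proof (rule cInf_eq_minimum)
    obtain q where "q \<in> Q" "g u q = 0" using gaps[OF u] unfolding gaps_def by blast
    then show "V u \<in> (\<Union>q \<in> Q. K u q)"
      using bounds[OF u] C by (auto intro!: bexI[of _ q])
  next
    fix k assume "k \<in> (\<Union>q \<in> Q. K u q)"
    then obtain q where q: "q \<in> Q" "k \<in> K u q" by blast
    then have "0 \<le> g u q" using gaps[OF u] unfolding gaps_def by blast
    then have "0 \<le> real_of_rat (g u q) / total_discount \<theta> u"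
      using total_discount_pos[of \<Sigma> \<theta> u, OF \<theta>_ge u] by (simp add: less_imp_le)
    then show "V u \<le> k" using bounds[OF u] q by fastforce
  qed
  have "finite_state \<Sigma> x" using finite_state_comp[OF fs_D, of snd] by (simp add: x_def[abs_def])
  then show ?thesis
    unfolding realizable_def using V0 Inf_eq V
    by (intro conjI exI[of _ x]) auto
qed

text \<open>This is the minimal cost of a two-state machine: an initial guess, \<open>True\<close>
  for \<open>F\<close> and \<open>False\<close> for \<open>G\<close>, is kept forever, so each state
  is reached at exactly one cost.\<close>

lemma realizable_min:
  assumes \<theta>_ge: "\<And>u. u \<in> finite_words \<Sigma> \<Longrightarrow> 2 \<le> \<theta> u"
    and fs_\<theta>: "finite_state \<Sigma> \<theta>"
    and F: "realizable \<Sigma> \<theta> F" and G: "realizable \<Sigma> \<theta> G"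
  shows "realizable \<Sigma> \<theta> (\<lambda>u. min (F u) (G u))"
proof -
  obtain x y where x: "F [] = 0" "finite_state \<Sigma> x"
      "\<forall>u \<in> lists \<Sigma>. \<forall>a \<in> \<Sigma>. F (u @ [a]) = F u + real_of_rat (x (u @ [a])) / total_discount \<theta> u"
    and y: "G [] = 0" "finite_state \<Sigma> y"
      "\<forall>u \<in> lists \<Sigma>. \<forall>a \<in> \<Sigma>. G (u @ [a]) = G u + real_of_rat (y (u @ [a])) / total_discount \<theta> u"
    using F G unfolding realizable_def by blast
  define T where "T u = {(True, True, x u), (False, False, y u)}" for u
  have "finite_state \<Sigma> T"
    using finite_state_comp[OF finite_state_pair[OF x(2) y(2)],
        of "\<lambda>(s, t). {(True, True, s), (False, False, t)}"] by (simp add: T_def[abs_def])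
  moreover have "\<exists>q' r. (q, q', r) \<in> T u" for q u by (cases q) (auto simp: T_def)
  ultimately have "realizable \<Sigma> \<theta> (\<lambda>u. Inf (\<Union>q \<in> UNIV. {if q then F u else G u}))"
    using \<theta>_ge fs_\<theta> x y by (intro realizable_min_cost[where T = T and I = UNIV]) (auto simp: T_def)
  moreover have "Inf (\<Union>q \<in> UNIV. {if q then F u else G u}) = min (F u) (G u)" for u
    by (simp add: UNIV_bool cInf_eq_Min min.commute)
  ultimately show ?thesis by simp
qed

section \<open>Finite runs of \<theta>-NMDAs\<close>

lemma fin_run_snoc:
  "fin_run A (u @ [a]) (p @ [q']) \<longleftrightarrow> fin_run A u p \<and> (p ! length u, a, q') \<in> transitions A"
  unfolding fin_run_def by (auto simp: nth_append less_Suc_eq all_conj_distrib)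

lemma fin_run_snocE:
  assumes "fin_run A (u @ [a]) p"
  obtains p' q' where "p = p' @ [q']" "fin_run A u p'" "(p' ! length u, a, q') \<in> transitions A"
proof (cases p rule: rev_cases)
  case Nil
  then show ?thesis using assms by (simp add: fin_run_def)
qed (use assms fin_run_snoc that in metis)

lemma fin_run_Nil: "fin_run A [] p \<longleftrightarrow> (\<exists>q \<in> initials A. p = [q])"
  unfolding fin_run_def by (auto simp: length_Suc_conv)

lemma fin_run_take:
  assumes "fin_run A w p" "n \<le> length w"
  shows "fin_run A (take n w) (take (Suc n) p)"
  using assms unfolding fin_run_def by auto

text \<open>The condition on \<theta> concerns only the last transition of a run; it is applied to
  the prefix of the run that ends with transition \<open>j\<close>.\<close>

lemma theta_nmda_discount:
  assumes A: "theta_nmda \<Sigma> \<theta> A" and "fin_run A w p" "w \<in> lists \<Sigma>" "j < length w"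
  shows "discount A (p ! j, w ! j, p ! Suc j) = of_nat (\<theta> (take (Suc j) w))"
proof -
  let ?u = "take (Suc j) w" and ?p = "take (Suc (Suc j)) p"
  have "?u \<in> finite_words \<Sigma>"
    using assms by (auto simp: finite_words_def dest: in_set_takeD)
  moreover have "fin_run A ?u ?p" using assms fin_run_take[of A w p "Suc j"] by simp
  ultimately have "discount A (?p ! (length ?u - 1), last ?u, ?p ! length ?u) = of_nat (\<theta> ?u)"
    using A unfolding theta_nmda_def by blast
  moreover have "last ?u = w ! j" "length ?u = Suc j"
    using assms by (simp_all add: take_Suc_conv_app_nth)
  ultimately show ?thesis by simp
qed

lemma fin_run_value_theta:
  assumes "theta_nmda \<Sigma> \<theta> A" "fin_run A w p" "w \<in> lists \<Sigma>"
  shows "fin_run_value A w p =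
    (\<Sum>i<length w. real_of_rat (weight A (p ! i, w ! i, p ! Suc i)) / total_discount \<theta> (take i w))"
  unfolding fin_run_value_def
proof (intro sum.cong refl)
  fix i assume "i \<in> {..<length w}"
  then have i: "i < length w" by simp
  have "(\<Prod>j<i. 1 / real_of_rat (discount A (p ! j, w ! j, p ! Suc j))) =
      (\<Prod>j<i. 1 / real (\<theta> (take (Suc j) (take i w))))"
    using i theta_nmda_discount[OF assms] by (intro prod.cong) (auto simp: min_def Suc_le_eq)
  also have "\<dots> = 1 / total_discount \<theta> (take i w)"
    using i by (simp add: total_discount_def prod_dividef)
  finally show "discounted_weight A (\<lambda>i. (p ! i, w ! i, p ! Suc i)) i =
      real_of_rat (weight A (p ! i, w ! i, p ! Suc i)) / total_discount \<theta> (take i w)"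
    by (simp add: discounted_weight_def)
qed

lemma fin_run_value_snoc:
  assumes A: "theta_nmda \<Sigma> \<theta> A" and run: "fin_run A (u @ [a]) (p @ [q'])"
    and "u \<in> lists \<Sigma>" "a \<in> \<Sigma>"
  shows "fin_run_value A (u @ [a]) (p @ [q']) =
    fin_run_value A u p + real_of_rat (weight A (p ! length u, a, q')) / total_discount \<theta> u"
proof -
  have p: "fin_run A u p" using run fin_run_snoc by metis
  then have len: "length p = Suc (length u)" by (simp add: fin_run_def)
  have "u @ [a] \<in> lists \<Sigma>" using assms by simp
  then show ?thesis
    using fin_run_value_theta[OF A run] fin_run_value_theta[OF A p] assms(3) len
    by (simp add: nth_append)
qed

lemma is_nmda_complete:
  assumes "is_nmda A" "q \<in> states A" "a \<in> alphabet A"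
  shows "\<exists>q' \<in> states A. (q, a, q') \<in> transitions A"
proof -
  obtain q' where "(q, a, q') \<in> transitions A" using assms unfolding is_nmda_def by blast
  moreover have "transitions A \<subseteq> states A \<times> alphabet A \<times> states A"
    using assms(1) unfolding is_nmda_def by blast
  ultimately show ?thesis by blast
qed

lemma theta_nmda_is_nmda:
  "theta_nmda \<Sigma> \<theta> A \<Longrightarrow> is_nmda A \<and> alphabet A = \<Sigma>"
  by (simp add: theta_nmda_def integral_nmda_def)

lemma finite_transitions: "is_nmda A \<Longrightarrow> finite (transitions A)"
  unfolding is_nmda_def by (meson finite_SigmaI finite_subset)

lemma fin_run_last_state:
  assumes "is_nmda A" "fin_run A u p"
  shows "p ! length u \<in> states A"
proof (cases u rule: rev_cases)
  case Nil
  then show ?thesis using assms unfolding is_nmda_def fin_run_def by auto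
next
  case (snoc v a)
  then have "(p ! length v, a, p ! length u) \<in> transitions A"
    using assms(2) unfolding fin_run_def by (auto dest!: spec[of _ "length v"])
  then show ?thesis using assms(1) unfolding is_nmda_def by blast
qed

lemma ex_fin_run:
  assumes "is_nmda A" "u \<in> lists (alphabet A)"
  shows "\<exists>p. fin_run A u p"
  using assms(2)
proof (induction u rule: rev_induct)
  case Nil
  then show ?case using assms(1) by (auto simp: fin_run_Nil is_nmda_def)
next
  case (snoc a u)
  then obtain p where p: "fin_run A u p" by auto
  then obtain q' where "(p ! length u, a, q') \<in> transitions A"
    using is_nmda_complete[OF assms(1) fin_run_last_state[OF assms(1) p]] snoc.prems by auto
  then show ?case using p fin_run_snoc by metis
qed

section \<open>From automata to machines\<close>

text \<open>Subset construction: all transitions on \<open>a\<close> from states reachable by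
  \<open>u\<close> share the discount factor \<open>\<theta> (u @ [a])\<close>, so it can be read
  off the reachable set.\<close>

lemma finite_state_theta:
  assumes A: "theta_nmda \<Sigma> \<theta> A"
  shows "finite_state \<Sigma> \<theta>"
proof -
  have nmda: "is_nmda A" "alphabet A = \<Sigma>" using theta_nmda_is_nmda[OF A] by auto
  define reach where "reach u = {p ! length u | p. fin_run A u p}" for u
  define out where "out a X = {(q, a, q') | q q'. q \<in> X \<and> (q, a, q') \<in> transitions A}" for a X
  have out_sub: "out a X \<subseteq> transitions A" for a X unfolding out_def by blast
  have reach: "reach (u @ [a]) = (\<lambda>(q, a, q'). q') ` out a (reach u)" for u a
  proof (intro set_eqI iffI)
    fix q' assume "q' \<in> reach (u @ [a])"
    then obtain p where "fin_run A (u @ [a]) p" "q' = p ! length (u @ [a])"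
      unfolding reach_def by blast
    then obtain p' where p': "fin_run A u p'" "(p' ! length u, a, q') \<in> transitions A"
      by (elim fin_run_snocE) (auto simp: fin_run_def nth_append)
    then show "q' \<in> (\<lambda>(q, a, q'). q') ` out a (reach u)"
      unfolding reach_def out_def by (intro image_eqI[of _ _ "(p' ! length u, a, q')"]) auto
  next
    fix q' assume "q' \<in> (\<lambda>(q, a, q'). q') ` out a (reach u)"
    then obtain p where p: "fin_run A u p" "(p ! length u, a, q') \<in> transitions A"
      unfolding reach_def out_def by auto
    then have "fin_run A (u @ [a]) (p @ [q'])" "(p @ [q']) ! length (u @ [a]) = q'"
      using fin_run_snoc[of A u a p] by (auto simp: fin_run_def nth_append)
    then show "q' \<in> reach (u @ [a])" unfolding reach_def by (metis (mono_tags, lifting) mem_Collect_eq)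
  qed
  have out: "out a (reach u) \<noteq> {} \<and> (\<forall>t \<in> out a (reach u). discount A t = of_nat (\<theta> (u @ [a])))"
    if u: "u \<in> lists \<Sigma>" "a \<in> \<Sigma>" for u a
  proof
    obtain p where p: "fin_run A (u @ [a]) p" using ex_fin_run[of A "u @ [a]"] nmda u by auto
    then have "p ! length (u @ [a]) \<in> reach (u @ [a])" unfolding reach_def by blast
    then show "out a (reach u) \<noteq> {}" using reach by auto
    show "\<forall>t \<in> out a (reach u). discount A t = of_nat (\<theta> (u @ [a]))"
    proof
      fix t assume "t \<in> out a (reach u)"
      then obtain p q' where t: "fin_run A u p" "t = (p ! length u, a, q')" "t \<in> transitions A"
        unfolding out_def reach_def by blast
      then have "fin_run A (u @ [a]) (p @ [q'])" using fin_run_snoc by metis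
      then show "discount A t = of_nat (\<theta> (u @ [a]))"
        using theta_nmda_discount[OF A, of "u @ [a]" "p @ [q']" "length u"] u t
        by (auto simp: nth_append fin_run_def)
    qed
  qed
  \<comment> \<open>On \<open>out a (reach u)\<close>, which is nonempty by completeness, all
    discount factors agree, so the choice is immaterial.\<close>
  define dis where "dis S = nat \<lfloor>discount A (SOME t. t \<in> S)\<rfloor>" for S
  have dis: "dis (out a (reach u)) = \<theta> (u @ [a])" and
    dis_in: "\<theta> (u @ [a]) \<in> (\<lambda>t. nat \<lfloor>discount A t\<rfloor>) ` transitions A"
    if "u \<in> lists \<Sigma>" "a \<in> \<Sigma>" for u a
  proof -
    have some: "(SOME t. t \<in> out a (reach u)) \<in> out a (reach u)" using out that some_in_eq by metis
    then show *: "dis (out a (reach u)) = \<theta> (u @ [a])" using out that by (simp add: dis_def)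
    have "(SOME t. t \<in> out a (reach u)) \<in> transitions A" by (rule subsetD[OF out_sub some])
    then show "\<theta> (u @ [a]) \<in> (\<lambda>t. nat \<lfloor>discount A t\<rfloor>) ` transitions A"
      unfolding *[symmetric] dis_def by (rule imageI)
  qed
  \<comment> \<open>The value \<open>\<theta> (u @ [a])\<close> is determined by the set reached
    before \<open>a\<close>, so it is kept in the state beside the set reached after
    \<open>a\<close>.\<close>
  have "finite_state \<Sigma> (\<lambda>u. (reach u, \<theta> u))"
  proof (rule finite_state_rec[where
        h = "\<lambda>a (X, _) _. ((\<lambda>(q, a, q'). q') ` out a X, dis (out a X))" and Y = "\<lambda>_. ()"])
    show "finite_state \<Sigma> (\<lambda>_. ())" by (rule finite_stateI[where S = "\<lambda>_. ()"]) auto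
    have "reach u \<in> Pow (states A)" for u
      using fin_run_last_state[OF nmda(1)] unfolding reach_def by blast
    \<comment> \<open>The value \<open>\<theta> []\<close> need not be a discount factor of
      \<open>A\<close> and is added as one extra element.\<close>
    moreover have "\<theta> u \<in> insert (\<theta> []) ((\<lambda>t. nat \<lfloor>discount A t\<rfloor>) ` transitions A)"
      if "u \<in> lists \<Sigma>" for u
      using that dis_in by (cases u rule: rev_cases) auto
    ultimately have "(\<lambda>u. (reach u, \<theta> u)) ` lists \<Sigma> \<subseteq>
        Pow (states A) \<times> insert (\<theta> []) ((\<lambda>t. nat \<lfloor>discount A t\<rfloor>) ` transitions A)"
      by blast
    moreover have "finite (Pow (states A))" using nmda unfolding is_nmda_def by simp
    ultimately show "finite ((\<lambda>u. (reach u, \<theta> u)) ` lists \<Sigma>)"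
      using finite_transitions[OF nmda(1)] by (meson finite_SigmaI finite_imageI finite_insert finite_subset)
  qed (simp add: reach dis)
  then show ?thesis using finite_state_comp[of \<Sigma> "\<lambda>u. (reach u, \<theta> u)" snd] by simp
qed

text \<open>Instance of \<open>realizable_min_cost\<close> in which runs are grouped by their last
  state.\<close>

lemma realizable_fin_value:
  assumes A: "theta_nmda \<Sigma> \<theta> A" and \<theta>_ge: "\<And>u. u \<in> finite_words \<Sigma> \<Longrightarrow> 2 \<le> \<theta> u"
  shows "realizable \<Sigma> \<theta> (fin_value A)"
proof -
  have nmda: "is_nmda A" "alphabet A = \<Sigma>" using theta_nmda_is_nmda[OF A] by auto
  \<comment> \<open>The edges depend only on the last letter; the empty set is a default for the
    empty word.\<close>
  define T where "T u = (if u = [] then {} else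
    (\<lambda>(q, a, q'). (q, q', weight A (q, a, q'))) ` {t \<in> transitions A. fst (snd t) = last u})" for u
  define K where "K u q = {fin_run_value A u p | p. fin_run A u p \<and> p ! length u = q}" for u q
  have T_snoc: "(q, q', r) \<in> T (u @ [a]) \<longleftrightarrow>
      (q, a, q') \<in> transitions A \<and> r = weight A (q, a, q')" for q q' r u a
    unfolding T_def by force
  have T_sub: "T u \<subseteq> (\<lambda>(q, a, q'). (q, q', weight A (q, a, q'))) ` transitions A" for u
    unfolding T_def by (simp, intro impI image_mono Collect_restrict)
  have fs_T: "finite_state \<Sigma> T"
  proof (rule finite_state_rec[where Y = "\<lambda>_. ()" and h = "\<lambda>a _ _. T [a]"])
    show "finite_state \<Sigma> (\<lambda>_. ())" by (rule finite_stateI[where S = "\<lambda>_. ()"]) auto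
    have "T ` lists \<Sigma> \<subseteq> Pow ((\<lambda>(q, a, q'). (q, q', weight A (q, a, q'))) ` transitions A)"
      using T_sub by blast
    then show "finite (T ` lists \<Sigma>)"
      using finite_transitions[OF nmda(1)] by (meson finite_Pow_iff finite_imageI finite_subset)
  qed (simp add: T_def)
  have "realizable \<Sigma> \<theta> (\<lambda>u. Inf (\<Union>q \<in> states A. K u q))"
  proof (rule realizable_min_cost[where T = T and I = "initials A"])
    show "finite (states A)" "initials A \<subseteq> states A" "initials A \<noteq> {}"
      using nmda unfolding is_nmda_def by auto
    show "finite (T u)" for u
      using T_sub[of u] finite_transitions[OF nmda(1)] by (meson finite_imageI finite_subset)
    show "T u \<subseteq> states A \<times> states A \<times> UNIV" for u
    proof -
      have "transitions A \<subseteq> states A \<times> alphabet A \<times> states A"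
        using nmda(1) unfolding is_nmda_def by blast
      then show ?thesis using T_sub[of u] by fastforce
    qed
    show "\<exists>q' r. (q, q', r) \<in> T (u @ [a])" if "a \<in> \<Sigma>" "q \<in> states A" for q u a
      using that is_nmda_complete[OF nmda(1)] nmda(2) unfolding T_snoc by metis
    show "K [] q = (if q \<in> initials A then {0} else {})" for q
      by (auto simp: K_def fin_run_Nil fin_run_value_def)
    show "K (u @ [a]) q' =
        {k + real_of_rat r / total_discount \<theta> u | q k r. (q, q', r) \<in> T (u @ [a]) \<and> k \<in> K u q}"
      (is "_ = ?R") if u: "u \<in> lists \<Sigma>" "a \<in> \<Sigma>" for u a q'
    proof (intro set_eqI iffI)
      fix k assume "k \<in> K (u @ [a]) q'"
      then obtain p where run: "fin_run A (u @ [a]) p"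
        and p: "p ! length (u @ [a]) = q'" "k = fin_run_value A (u @ [a]) p" unfolding K_def by blast
      then obtain p' where p': "p = p' @ [q']" "fin_run A u p'" "(p' ! length u, a, q') \<in> transitions A"
        by (elim fin_run_snocE) (auto simp: fin_run_def nth_append)
      then show "k \<in> ?R"
        using fin_run_value_snoc[OF A _ u, of p' q'] run p
        by (auto simp: T_snoc K_def intro!: exI[of _ "p' ! length u"])
    next
      fix k assume "k \<in> ?R"
      then obtain p where p: "fin_run A u p" "(p ! length u, a, q') \<in> transitions A"
        "k = fin_run_value A u p + real_of_rat (weight A (p ! length u, a, q')) / total_discount \<theta> u"
        unfolding T_snoc K_def by blast
      then have run: "fin_run A (u @ [a]) (p @ [q'])" using fin_run_snoc by metis
      moreover have "(p @ [q']) ! length (u @ [a]) = q'" using p by (simp add: fin_run_def nth_append)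
      ultimately show "k \<in> K (u @ [a]) q'"
        using fin_run_value_snoc[OF A run u] p(3) unfolding K_def by force
    qed
  qed (use \<theta>_ge fs_T finite_state_theta[OF A] in auto)
  moreover have "(\<Union>q \<in> states A. K u q) = {fin_run_value A u p | p. fin_run A u p}" for u
    using fin_run_last_state[OF nmda(1)] unfolding K_def by blast
  ultimately show ?thesis unfolding fin_value_def[abs_def] by simp
qed

section \<open>From machines to automata\<close>

text \<open>A machine computing \<open>x\<close> and \<theta> together is turned into a
  deterministic automaton. A machine outputs after reading the letter, so weight and discount factor
  of a transition are taken from its target state.\<close>

lemma realizable_imp_theta_nmda:
  fixes \<Sigma> :: "'s set"
  assumes fin: "finite \<Sigma>" "\<Sigma> \<noteq> {}"
    and \<theta>_ge: "\<And>u. u \<in> finite_words \<Sigma> \<Longrightarrow> 2 \<le> \<theta> u"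
    and fs_\<theta>: "finite_state \<Sigma> \<theta>" and F: "realizable \<Sigma> \<theta> F"
  shows "\<exists>A :: ('s, nat) nmda. theta_nmda \<Sigma> \<theta> A \<and> (\<forall>w \<in> lists \<Sigma>. fin_value A w = F w)"
proof -
  obtain x where F0: "F [] = 0" and fs_x: "finite_state \<Sigma> x" and F_snoc:
    "\<And>u a. u \<in> lists \<Sigma> \<Longrightarrow> a \<in> \<Sigma> \<Longrightarrow>
       F (u @ [a]) = F u + real_of_rat (x (u @ [a])) / total_discount \<theta> u"
    using F unfolding realizable_def by blast
  obtain S :: "'s list \<Rightarrow> nat" where finS: "finite (S ` lists \<Sigma>)" and S:
    "\<And>u v. u \<in> lists \<Sigma> \<Longrightarrow> v \<in> lists \<Sigma> \<Longrightarrow> S u = S v \<Longrightarrow> x u = x v \<and> \<theta> u = \<theta> v"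
    "\<And>u v a. u \<in> lists \<Sigma> \<Longrightarrow> v \<in> lists \<Sigma> \<Longrightarrow> S u = S v \<Longrightarrow> a \<in> \<Sigma> \<Longrightarrow> S (u @ [a]) = S (v @ [a])"
    using finite_state_pair[OF fs_x fs_\<theta>] unfolding finite_state_def prod.inject by blast
  \<comment> \<open>A representative word for each state; outputs depend only on the state, so
    \<open>word_eq\<close> recovers the values at the original word.\<close>
  define word where "word q = (SOME v. v \<in> lists \<Sigma> \<and> S v = q)" for q
  have word: "word (S u) \<in> lists \<Sigma> \<and> S (word (S u)) = S u" if "u \<in> lists \<Sigma>" for u
    unfolding word_def using someI[of "\<lambda>v. v \<in> lists \<Sigma> \<and> S v = S u" u] that by blast
  define A :: "('s, nat) nmda" where "A =
    \<lparr>alphabet = \<Sigma>, states = S ` lists \<Sigma>, initials = {S []},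
     transitions = {(S u, a, S (u @ [a])) | u a. u \<in> lists \<Sigma> \<and> a \<in> \<Sigma>},
     weight = (\<lambda>(_, _, q'). x (word q')), discount = (\<lambda>(_, _, q'). of_nat (\<theta> (word q')))\<rparr>"
  have word_eq: "x (word (S u)) = x u" "\<theta> (word (S u)) = \<theta> u" if "u \<in> lists \<Sigma>" for u
    using S(1)[of "word (S u)" u] word[OF that] that by auto
  have \<theta>_snoc: "2 \<le> \<theta> (u @ [a])" if "u \<in> lists \<Sigma>" "a \<in> \<Sigma>" for u a
    using that by (intro \<theta>_ge) (auto simp: finite_words_def)
  have "is_nmda A"
    unfolding is_nmda_def
  proof (intro conjI ballI)
    fix t assume "t \<in> transitions A"
    then obtain u a where u: "u \<in> lists \<Sigma>" "a \<in> \<Sigma>" "t = (S u, a, S (u @ [a]))"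
      by (auto simp: A_def)
    then have "discount A t = of_nat (\<theta> (u @ [a]))"
      using word_eq[of "u @ [a]"] by (simp add: A_def)
    then show "1 < discount A t" using \<theta>_snoc[OF u(1,2)] by simp
  qed (use fin finS in \<open>auto simp: A_def intro!: imageI\<close>)
  moreover have "discount A t \<in> \<int>" for t by (cases t) (simp add: A_def)
  ultimately have integral: "integral_nmda A" by (simp add: integral_nmda_def)
  \<comment> \<open>Equal states have equal successors, so each word has exactly one run and the
    infimum in \<open>fin_value\<close> is over a singleton.\<close>
  have run: "fin_run A w p \<longleftrightarrow> p = map (\<lambda>i. S (take i w)) [0..<Suc (length w)]"
    if "w \<in> lists \<Sigma>" for w p
    using that
  proof (induction w arbitrary: p rule: rev_induct)
    case Nil
    then show ?case by (simp add: fin_run_Nil A_def)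
  next
    case (snoc a w)
    then have w: "w \<in> lists \<Sigma>" "a \<in> \<Sigma>" by auto
    let ?p = "map (\<lambda>i. S (take i w)) [0..<Suc (length w)]"
    have tr: "(S w, a, q') \<in> transitions A \<longleftrightarrow> q' = S (w @ [a])" for q'
    proof
      assume "(S w, a, q') \<in> transitions A"
      then obtain v where "v \<in> lists \<Sigma>" "S v = S w" "q' = S (v @ [a])"
        unfolding A_def by (simp del: in_lists_conv_set) metis
      then show "q' = S (w @ [a])" using S(2) w by blast
    qed (use w in \<open>auto simp: A_def\<close>)
    have last: "?p ! length w = S w" by (simp del: upt_Suc)
    have eq: "map (\<lambda>i. S (take i (w @ [a]))) [0..<Suc (length (w @ [a]))] = ?p @ [S (w @ [a])]"
      by simp
    show ?case
    proof
      assume "fin_run A (w @ [a]) p"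
      then obtain p' q' where p: "p = p' @ [q']" "fin_run A w p'" "(p' ! length w, a, q') \<in> transitions A"
        by (rule fin_run_snocE)
      then have "p' = ?p" using snoc.IH[OF w(1)] by blast
      then show "p = map (\<lambda>i. S (take i (w @ [a]))) [0..<Suc (length (w @ [a]))]"
        using p last tr unfolding eq by simp
    next
      assume "p = map (\<lambda>i. S (take i (w @ [a]))) [0..<Suc (length (w @ [a]))]"
      then show "fin_run A (w @ [a]) p"
        unfolding eq using fin_run_snoc[of A w a ?p "S (w @ [a])"] snoc.IH[OF w(1), of ?p] last tr by simp
    qed
  qed
  have theta: "theta_nmda \<Sigma> \<theta> A"
    unfolding theta_nmda_def
  proof (intro conjI ballI allI impI integral)
    show "alphabet A = \<Sigma>" by (simp add: A_def)
    fix u p assume u: "u \<in> finite_words \<Sigma>" and "fin_run A u p"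
    then have "u \<in> lists \<Sigma>" "p = map (\<lambda>i. S (take i u)) [0..<Suc (length u)]"
      using run unfolding finite_words_def by blast+
    then show "discount A (p ! (length u - 1), last u, p ! length u) = of_nat (\<theta> u)"
      using word_eq[of u] by (simp add: A_def del: upt_Suc)
  qed
  moreover have "fin_value A w = F w" if "w \<in> lists \<Sigma>" for w
  proof -
    define run_of where "run_of w = map (\<lambda>i. S (take i w)) [0..<Suc (length w)]" for w
    have "fin_run_value A w (run_of w) = F w"
      using that
    proof (induction w rule: rev_induct)
      case Nil
      then show ?case by (simp add: F0 fin_run_value_def)
    next
      case (snoc a w)
      then have w: "w \<in> lists \<Sigma>" "a \<in> \<Sigma>" "w @ [a] \<in> lists \<Sigma>" by auto
      have eq: "run_of (w @ [a]) = run_of w @ [S (w @ [a])]" by (simp add: run_of_def)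
      have "fin_run A (w @ [a]) (run_of (w @ [a]))" using run[OF w(3)] by (simp add: run_of_def)
      then show ?case
        using fin_run_value_snoc[OF theta _ w(1,2), of "run_of w" "S (w @ [a])"]
          snoc.IH[OF w(1)] F_snoc[OF w(1,2)] word_eq(1)[OF w(3)]
        unfolding eq by (simp add: A_def)
    qed
    then show ?thesis using run[OF that] by (simp add: fin_value_def run_of_def)
  qed
  ultimately show ?thesis by blast
qed

section \<open>Infinite words as limits of their prefixes\<close>

text \<open>Also applied to the state sequence of an infinite run, where \<open>n\<close> letters go
  with \<open>Suc n\<close> states.\<close>

definition word_prefix :: "(nat \<Rightarrow> 's) \<Rightarrow> nat \<Rightarrow> 's list" where
  "word_prefix w n = map w [0..<n]"

lemma length_word_prefix [simp]: "length (word_prefix w n) = n"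
  by (simp add: word_prefix_def)

lemma nth_word_prefix [simp]: "i < n \<Longrightarrow> word_prefix w n ! i = w i"
  by (simp add: word_prefix_def)

lemma take_word_prefix: "i \<le> n \<Longrightarrow> take i (word_prefix w n) = word_prefix w i"
  by (simp add: word_prefix_def take_map)

lemma word_prefix_in_lists: "w \<in> infinite_words \<Sigma> \<Longrightarrow> word_prefix w n \<in> lists \<Sigma>"
  by (auto simp: word_prefix_def infinite_words_def image_subset_iff)

lemma word_prefix_in_finite_words:
  "w \<in> infinite_words \<Sigma> \<Longrightarrow> 0 < n \<Longrightarrow> word_prefix w n \<in> finite_words \<Sigma>"
  using word_prefix_in_lists[of w \<Sigma> n] by (auto simp: finite_words_def word_prefix_def)

lemma fin_run_word_prefix:
  assumes "inf_run A w p"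
  shows "fin_run A (word_prefix w n) (word_prefix p (Suc n))"
  using assms unfolding fin_run_def inf_run_def by simp

lemma ex_inf_run_extension:
  assumes A: "is_nmda A" and w: "w \<in> infinite_words (alphabet A)"
    and p: "fin_run A (word_prefix w n) p"
  shows "\<exists>p'. inf_run A w p' \<and> word_prefix p' (Suc n) = p"
proof -
  have sub: "transitions A \<subseteq> states A \<times> alphabet A \<times> states A"
    using A unfolding is_nmda_def by blast
  have len: "length p = Suc n" using p by (simp add: fin_run_def)
  have tr: "(p ! i, w i, p ! Suc i) \<in> transitions A" if "i < n" for i
    using p that unfolding fin_run_def by simp
  have p0: "p ! 0 \<in> initials A" using p by (simp add: fin_run_def)
  \<comment> \<open>The chosen states follow \<open>p\<close> up to index \<open>n\<close>; from
    there on completeness supplies successors.\<close>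
  have "\<exists>f. \<forall>i. (f i \<in> states A \<and> (i \<le> n \<longrightarrow> f i = p ! i)) \<and> (f i, w i, f (Suc i)) \<in> transitions A"
  proof (rule dependent_nat_choice)
    show "\<exists>q. q \<in> states A \<and> (0 \<le> n \<longrightarrow> q = p ! 0)"
      using p0 A unfolding is_nmda_def by blast
    fix q i assume q: "q \<in> states A \<and> (i \<le> n \<longrightarrow> q = p ! i)"
    show "\<exists>q'. (q' \<in> states A \<and> (Suc i \<le> n \<longrightarrow> q' = p ! Suc i)) \<and> (q, w i, q') \<in> transitions A"
    proof (cases "i < n")
      case True
      then have "(q, w i, p ! Suc i) \<in> transitions A" using tr q by simp
      then show ?thesis using sub by blast
    next
      case False
      have "w i \<in> alphabet A" using w by (auto simp: infinite_words_def)
      then show ?thesis using is_nmda_complete[OF A] q False by fastforce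
    qed
  qed
  then obtain f where f: "\<And>i. i \<le> n \<Longrightarrow> f i = p ! i" "\<And>i. (f i, w i, f (Suc i)) \<in> transitions A"
    by blast
  then have "inf_run A w f" using p0 by (simp add: inf_run_def)
  moreover have "word_prefix f (Suc n) = p"
    using f(1) len by (intro nth_equalityI) (auto simp del: upt_Suc)
  ultimately show ?thesis by blast
qed

text \<open>Factors of at least 2 bound the \<open>i\<close>-th term by \<open>M / 2 ^ i\<close>,
  and the geometric tail from \<open>n\<close> on sums to the stated error. The error is the same
  for all runs, which lets it pass to infima.\<close>

lemma inf_run_value_approx:
  assumes A: "theta_nmda \<Sigma> \<theta> A" and \<theta>_ge: "\<And>u. u \<in> finite_words \<Sigma> \<Longrightarrow> 2 \<le> \<theta> u"
    and w: "w \<in> infinite_words \<Sigma>" and run: "inf_run A w p"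
    and M: "\<And>t. t \<in> transitions A \<Longrightarrow> \<bar>real_of_rat (weight A t)\<bar> \<le> M"
  shows "\<bar>inf_run_value A w p - fin_run_value A (word_prefix w n) (word_prefix p (Suc n))\<bar>
    \<le> 2 * M * (1 / 2) ^ n"
proof -
  define D where "D = discounted_weight A (\<lambda>i. (p i, w i, p (Suc i)))"
  have tr: "(p i, w i, p (Suc i)) \<in> transitions A" for i using run by (simp add: inf_run_def)
  have D: "D i = real_of_rat (weight A (p i, w i, p (Suc i))) / total_discount \<theta> (word_prefix w i)" for i
  proof -
    have "discount A (p j, w j, p (Suc j)) = of_nat (\<theta> (take (Suc j) (word_prefix w i)))"
      if "j < i" for j
      using theta_nmda_discount[OF A fin_run_word_prefix[OF run, of i] word_prefix_in_lists[OF w], of j] that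
      by simp
    then have "(\<Prod>j<i. 1 / real_of_rat (discount A (p j, w j, p (Suc j)))) =
        1 / total_discount \<theta> (word_prefix w i)"
      by (simp add: total_discount_def prod_dividef)
    then show ?thesis by (simp add: D_def discounted_weight_def)
  qed
  have D_bound: "\<bar>D i\<bar> \<le> M * (1 / 2) ^ i" for i
  proof -
    have "2 ^ i \<le> total_discount \<theta> (word_prefix w i)"
      using total_discount_ge[of \<Sigma> \<theta> "word_prefix w i", OF \<theta>_ge word_prefix_in_lists[OF w]] by simp
    then have "\<bar>D i\<bar> \<le> M / 2 ^ i"
      unfolding D abs_divide using M[OF tr[of i]] order_trans[OF abs_ge_zero M[OF tr[of i]]]
      by (intro frac_le) auto
    then show ?thesis by (simp add: power_one_over)
  qed
  have geo: "summable (\<lambda>i. M * (1 / 2 :: real) ^ (i + k))" for k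
    by (intro summable_mult iffD2[OF summable_iff_shift] summable_geometric) simp
  have sum_D: "summable D" using D_bound by (intro summable_comparison_test'[OF geo[of 0], of 0]) simp
  have fin: "fin_run_value A (word_prefix w n) (word_prefix p (Suc n)) = (\<Sum>i<n. D i)"
    unfolding fin_run_value_theta[OF A fin_run_word_prefix[OF run] word_prefix_in_lists[OF w]] D
    by (intro sum.cong) (auto simp: take_word_prefix)
  have "inf_run_value A w p - (\<Sum>i<n. D i) = (\<Sum>i. D (i + n))"
    using suminf_minus_initial_segment[OF sum_D, of n] by (simp add: inf_run_value_def D_def)
  moreover have "summable (\<lambda>i. \<bar>D (i + n)\<bar>)"
    using D_bound by (intro summable_comparison_test'[OF geo[of n], of 0]) simp
  moreover from this have "\<bar>\<Sum>i. D (i + n)\<bar> \<le> (\<Sum>i. \<bar>D (i + n)\<bar>)" by (rule summable_rabs)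
  moreover have "(\<Sum>i. \<bar>D (i + n)\<bar>) \<le> (\<Sum>i. M * (1 / 2) ^ (i + n))"
    by (rule suminf_le[OF D_bound calculation(2) geo])
  moreover have "(\<Sum>i. M * (1 / 2 :: real) ^ (i + n)) = 2 * M * (1 / 2) ^ n"
  proof -
    have "(\<Sum>i. (1 / 2 :: real) ^ i * (M * (1 / 2) ^ n)) = 2 * (M * (1 / 2) ^ n)"
      using suminf_mult2[of "\<lambda>i. (1 / 2 :: real) ^ i" "M * (1 / 2) ^ n"]
      by (simp add: suminf_geometric summable_geometric)
    then show ?thesis by (simp add: power_add mult_ac)
  qed
  ultimately show ?thesis using fin by simp
qed

text \<open>By extending finite runs and truncating infinite ones, each value in \<open>X n\<close>
  is within \<open>e n\<close> of one in \<open>Y\<close> and conversely. The infima then differ by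
  at most \<open>e n\<close>, which tends to 0.\<close>

lemma fin_value_tendsto_inf_value:
  assumes A: "theta_nmda \<Sigma> \<theta> A" and \<theta>_ge: "\<And>u. u \<in> finite_words \<Sigma> \<Longrightarrow> 2 \<le> \<theta> u"
    and w: "w \<in> infinite_words \<Sigma>"
  shows "(\<lambda>n. fin_value A (word_prefix w n)) \<longlonglongrightarrow> inf_value A w"
proof -
  have nmda: "is_nmda A" "alphabet A = \<Sigma>" using theta_nmda_is_nmda[OF A] by auto
  define M where "M = Max ((\<lambda>t. \<bar>real_of_rat (weight A t)\<bar>) ` transitions A)"
  have M: "\<bar>real_of_rat (weight A t)\<bar> \<le> M" if "t \<in> transitions A" for t
    unfolding M_def using that finite_transitions[OF nmda(1)] by simp
  define e where "e n = 2 * M * (1 / 2) ^ n" for n :: nat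
  have approx: "\<bar>inf_run_value A w p - fin_run_value A (word_prefix w n) (word_prefix p (Suc n))\<bar> \<le> e n"
    if "inf_run A w p" for p n
    unfolding e_def using inf_run_value_approx[of \<Sigma> \<theta> A w p M n] A \<theta>_ge w that M by blast
  define X where "X n = {fin_run_value A (word_prefix w n) p | p. fin_run A (word_prefix w n) p}" for n
  define Y where "Y = {inf_run_value A w p | p. inf_run A w p}"
  have XY: "\<exists>y \<in> Y. \<bar>y - x\<bar> \<le> e n" if x: "x \<in> X n" for x n
  proof -
    obtain p where p: "fin_run A (word_prefix w n) p" "x = fin_run_value A (word_prefix w n) p"
      using x unfolding X_def by blast
    obtain p' where "inf_run A w p'" "word_prefix p' (Suc n) = p"
      using ex_inf_run_extension[OF nmda(1) _ p(1)] w nmda by auto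
    then show ?thesis using approx[of p' n] p(2) unfolding Y_def by blast
  qed
  have YX: "\<exists>x \<in> X n. \<bar>y - x\<bar> \<le> e n" if y: "y \<in> Y" for y n
  proof -
    obtain p where "inf_run A w p" "y = inf_run_value A w p" using y unfolding Y_def by blast
    then show ?thesis using approx[of p n] fin_run_word_prefix[of A w p n] unfolding X_def by blast
  qed
  have X_ne: "X n \<noteq> {}" for n
    using ex_fin_run[OF nmda(1), of "word_prefix w n"] word_prefix_in_lists[OF w] nmda(2)
    unfolding X_def by blast
  then have Y_ne: "Y \<noteq> {}" using XY by blast
  \<comment> \<open>The empty prefix has the single value 0; comparison with it bounds the values of
    all infinite runs below by \<open>- e 0\<close>.\<close>
  have "X 0 = {0}" using X_ne[of 0] by (auto simp: X_def fin_run_value_def)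
  then have Y_lower: "- e 0 \<le> y" if "y \<in> Y" for y using YX[OF that, of 0] by auto
  then have Y_bdd: "bdd_below Y" by (rule bdd_belowI)
  have X_bdd: "bdd_below (X n)" for n
  proof (rule bdd_belowI)
    fix x assume "x \<in> X n"
    then obtain y where "y \<in> Y" "\<bar>y - x\<bar> \<le> e n" using XY by blast
    then show "- e 0 - e n \<le> x" using Y_lower[of y] by linarith
  qed
  have "\<bar>Inf (X n) - Inf Y\<bar> \<le> e n" for n
  proof -
    have "Inf (X n) - e n \<le> Inf Y"
    proof (rule cInf_greatest[OF Y_ne])
      fix y assume "y \<in> Y"
      then obtain x where "x \<in> X n" "\<bar>y - x\<bar> \<le> e n" using YX by blast
      then show "Inf (X n) - e n \<le> y" using cInf_lower[OF _ X_bdd[of n], of x] by linarith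
    qed
    moreover have "Inf Y - e n \<le> Inf (X n)"
    proof (rule cInf_greatest[OF X_ne])
      fix x assume "x \<in> X n"
      then obtain y where "y \<in> Y" "\<bar>y - x\<bar> \<le> e n" using XY by blast
      then show "Inf Y - e n \<le> x" using cInf_lower[OF _ Y_bdd, of y] by linarith
    qed
    ultimately show ?thesis by linarith
  qed
  then have le: "norm (Inf (X n) - Inf Y) \<le> norm (e n) * 1" for n
    by (metis abs_ge_self mult.right_neutral order_trans real_norm_def)
  have "e \<longlonglongrightarrow> 0"
    unfolding e_def[abs_def] by (intro tendsto_mult_right_zero LIMSEQ_power_zero) simp
  then have "(\<lambda>n. Inf (X n) - Inf Y) \<longlonglongrightarrow> 0"
    by (rule tendsto_0_le[where K = 1]) (intro always_eventually allI le)
  then have "(\<lambda>n. Inf (X n)) \<longlonglongrightarrow> Inf Y" by (rule LIM_zero_cancel)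
  then show ?thesis by (simp add: fin_value_def inf_value_def X_def Y_def)
qed

lemma inf_value_eqI:
  assumes "theta_nmda \<Sigma> \<theta> A" and "\<And>u. u \<in> finite_words \<Sigma> \<Longrightarrow> 2 \<le> \<theta> u"
    and w: "w \<in> infinite_words \<Sigma>"
    and eq: "\<And>u. u \<in> finite_words \<Sigma> \<Longrightarrow> fin_value A u = F u"
    and lim: "(\<lambda>n. F (word_prefix w n)) \<longlonglongrightarrow> l"
  shows "inf_value A w = l"
proof (rule LIMSEQ_unique)
  show "(\<lambda>n. fin_value A (word_prefix w n)) \<longlonglongrightarrow> inf_value A w"
    using fin_value_tendsto_inf_value[of \<Sigma> \<theta> A w] assms by blast
  \<comment> \<open>The prefix of length 0 is not in \<open>finite_words\<close>, so the equation is
    available only from length 1 on.\<close>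
  have "eventually (\<lambda>n. F (word_prefix w n) = fin_value A (word_prefix w n)) sequentially"
    using eventually_gt_at_top[of "0 :: nat"]
    by (rule eventually_mono) (simp add: eq word_prefix_in_finite_words[OF w])
  then show "(\<lambda>n. fin_value A (word_prefix w n)) \<longlonglongrightarrow> l"
    using lim by (rule Lim_transform_eventually[rotated])
qed

section \<open>Closure under the five operations\<close>

theorem theorem4p8:
  fixes \<Sigma> :: "'s set" and \<theta> :: "'s list \<Rightarrow> nat"
    and A :: "('s, 'p) nmda" and B :: "('s, 'q) nmda" and c :: rat
  assumes "choice_function \<Sigma> \<theta>"
    and "theta_nmda \<Sigma> \<theta> A"
    and "theta_nmda \<Sigma> \<theta> B"
  shows "(\<exists>(C1 :: ('s, nat) nmda) (C2 :: ('s, nat) nmda) (C3 :: ('s, nat) nmda)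
           (C4 :: ('s, nat) nmda) (C5 :: ('s, nat) nmda).
          theta_nmda \<Sigma> \<theta> C1 \<and> theta_nmda \<Sigma> \<theta> C2 \<and> theta_nmda \<Sigma> \<theta> C3 \<and>
          theta_nmda \<Sigma> \<theta> C4 \<and> theta_nmda \<Sigma> \<theta> C5 \<and>
          (\<forall>w \<in> finite_words \<Sigma>.
             fin_value C1 w = min (fin_value A w) (fin_value B w) \<and>
             fin_value C2 w = max (fin_value A w) (fin_value B w) \<and>
             fin_value C3 w = fin_value A w + fin_value B w \<and>
             fin_value C4 w = fin_value A w - fin_value B w \<and>
             fin_value C5 w = real_of_rat c * fin_value A w))
      \<and>
        (\<exists>(C1 :: ('s, nat) nmda) (C2 :: ('s, nat) nmda) (C3 :: ('s, nat) nmda)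
           (C4 :: ('s, nat) nmda) (C5 :: ('s, nat) nmda).
          theta_nmda \<Sigma> \<theta> C1 \<and> theta_nmda \<Sigma> \<theta> C2 \<and> theta_nmda \<Sigma> \<theta> C3 \<and>
          theta_nmda \<Sigma> \<theta> C4 \<and> theta_nmda \<Sigma> \<theta> C5 \<and>
          (\<forall>w \<in> infinite_words \<Sigma>.
             inf_value C1 w = min (inf_value A w) (inf_value B w) \<and>
             inf_value C2 w = max (inf_value A w) (inf_value B w) \<and>
             inf_value C3 w = inf_value A w + inf_value B w \<and>
             inf_value C4 w = inf_value A w - inf_value B w \<and>
             inf_value C5 w = real_of_rat c * inf_value A w))"
proof -
  have \<theta>_ge: "2 \<le> \<theta> u" if "u \<in> finite_words \<Sigma>" for u
  proof -
    have "\<theta> u \<notin> {0, 1}" using assms(1) that unfolding choice_function_def by blast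
    then show ?thesis by auto
  qed
  have fin: "finite \<Sigma>" "\<Sigma> \<noteq> {}" using theta_nmda_is_nmda[OF assms(2)] unfolding is_nmda_def by auto
  note fs_\<theta> = finite_state_theta[OF assms(2)]
  let ?F = "fin_value A" and ?G = "fin_value B"
  have F: "realizable \<Sigma> \<theta> ?F" and G: "realizable \<Sigma> \<theta> ?G"
    using realizable_fin_value[of \<Sigma> \<theta>] assms \<theta>_ge by blast+
  have lin: "realizable \<Sigma> \<theta> (\<lambda>u. real_of_rat a * ?F u + real_of_rat b * ?G u)" for a b
    using realizable_linear_combination[OF F G] .
  have Fmin: "realizable \<Sigma> \<theta> (\<lambda>u. min (?F u) (?G u))"
    by (rule realizable_min[OF \<theta>_ge fs_\<theta> F G])
  have sum: "realizable \<Sigma> \<theta> (\<lambda>u. ?F u + ?G u)" using lin[of 1 1] by simp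
  have diff: "realizable \<Sigma> \<theta> (\<lambda>u. ?F u - ?G u)" using lin[of 1 "-1"] by (simp add: of_rat_minus)
  have scale: "realizable \<Sigma> \<theta> (\<lambda>u. real_of_rat c * ?F u)" using lin[of c 0] by simp
  have "max x y = x + y - min x y" for x y :: real by (simp add: max_def min_def)
  then have Fmax: "realizable \<Sigma> \<theta> (\<lambda>u. max (?F u) (?G u))"
    using realizable_linear_combination[OF sum Fmin, of 1 "-1"] by (simp add: of_rat_minus)
  have ex: "\<exists>C :: ('s, nat) nmda. theta_nmda \<Sigma> \<theta> C \<and> (\<forall>u \<in> finite_words \<Sigma>. fin_value C u = H u)"
    if "realizable \<Sigma> \<theta> H" for H
    using realizable_imp_theta_nmda[OF fin \<theta>_ge fs_\<theta> that] unfolding finite_words_def by auto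
  obtain C1 :: "('s, nat) nmda" where C1: "theta_nmda \<Sigma> \<theta> C1"
    "\<And>u. u \<in> finite_words \<Sigma> \<Longrightarrow> fin_value C1 u = min (?F u) (?G u)" using ex[OF Fmin] by blast
  obtain C2 :: "('s, nat) nmda" where C2: "theta_nmda \<Sigma> \<theta> C2"
    "\<And>u. u \<in> finite_words \<Sigma> \<Longrightarrow> fin_value C2 u = max (?F u) (?G u)" using ex[OF Fmax] by blast
  obtain C3 :: "('s, nat) nmda" where C3: "theta_nmda \<Sigma> \<theta> C3"
    "\<And>u. u \<in> finite_words \<Sigma> \<Longrightarrow> fin_value C3 u = ?F u + ?G u" using ex[OF sum] by blast
  obtain C4 :: "('s, nat) nmda" where C4: "theta_nmda \<Sigma> \<theta> C4"
    "\<And>u. u \<in> finite_words \<Sigma> \<Longrightarrow> fin_value C4 u = ?F u - ?G u" using ex[OF diff] by blast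
  obtain C5 :: "('s, nat) nmda" where C5: "theta_nmda \<Sigma> \<theta> C5"
    "\<And>u. u \<in> finite_words \<Sigma> \<Longrightarrow> fin_value C5 u = real_of_rat c * ?F u" using ex[OF scale] by blast
  have inf: "inf_value C1 w = min (inf_value A w) (inf_value B w) \<and>
      inf_value C2 w = max (inf_value A w) (inf_value B w) \<and>
      inf_value C3 w = inf_value A w + inf_value B w \<and>
      inf_value C4 w = inf_value A w - inf_value B w \<and>
      inf_value C5 w = real_of_rat c * inf_value A w" if w: "w \<in> infinite_words \<Sigma>" for w
  proof -
    note limA = fin_value_tendsto_inf_value[OF assms(2) \<theta>_ge w]
    note limB = fin_value_tendsto_inf_value[OF assms(3) \<theta>_ge w]
    \<comment> \<open>All five operations are continuous, so the equations on prefixes pass to the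
      limit.\<close>
    show ?thesis
      by (intro conjI inf_value_eqI[OF C1(1) \<theta>_ge w C1(2)] inf_value_eqI[OF C2(1) \<theta>_ge w C2(2)]
          inf_value_eqI[OF C3(1) \<theta>_ge w C3(2)] inf_value_eqI[OF C4(1) \<theta>_ge w C4(2)]
          inf_value_eqI[OF C5(1) \<theta>_ge w C5(2)]
          tendsto_min tendsto_max tendsto_add tendsto_diff tendsto_mult tendsto_const limA limB)
  qed
  show ?thesis
    by (rule conjI;
        rule exI[of _ C1], rule exI[of _ C2], rule exI[of _ C3], rule exI[of _ C4], rule exI[of _ C5])
       (simp_all add: C1 C2 C3 C4 C5 inf)
qed

end
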